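(* The Fréchet space $\mathcal{S}(\mathbb{R}_+)$, together with the Mellin convolution $\star:\mathcal{S}(\mathbb{R}_+)\times\mathcal{S}(\mathbb{R}_+)\to\mathcal{S}(\mathbb{R}_+)$, $$f\star g(x) := \int_0^\infty y^{-1} f(xy^{-1})\, g(y)\, dy, \qquad x\in\mathbb{R}_+,$$ is a commutative Fréchet algebra.
   Context: $\mathbb{R}_+=(0,\infty)$, $\mathbb{N}_0=\{0,1,2,\ldots\}$. $\mathcal{S}(\mathbb{R}_+)$ is the real vector space of all $f\in C^\infty(\mathbb{R}_+)$ (real-valued) such that for all $\alpha\in\mathbb{Z}$ and $\beta\in\mathbb{N}_0$ one has $p_{\alpha,\beta}(f) := \sup_{x\in\mathbb{R}_+} |x^\alpha f^{(\beta)}(x)| < \infty$. It is a Fréchet space with the locally convex topology generated by the seminorms $(p_{\alpha,\beta})_{\alpha\in\mathbb{Z},\beta\in\mathbb{N}_0}$. A (real) Fréchet space $\mathcal{F}$ together with a multiplication $\odot:\mathcal{F}\times\mathcal{F}\to\mathcal{F}$ is called a Fréchet algebra if: (i) $c\cdot(f\odot g)=(c\cdot f)\odot g=f\odot(c\cdot g)$ for all $c\in\mathbb{R}$, $f,g\in\mathcal{F}$; (ii) $(f\odot g)\odot h=f\odot(g\odot h)$ for all $f,g,h\in\mathcal{F}$; (iii) $f\odot(g+h)=f\odot g+f\odot h$ and $(f+g)\odot h=f\odot h+g\odot h$ for all $f,g,h\in\mathcal{F}$; (iv) $\odot$ is continuous as a map $\mathcal{F}\times\mathcal{F}\to\mathcal{F}$.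 It is called commutative if in addition $f\odot g=g\odot f$ for all $f,g\in\mathcal{F}$. *)

theory Defs
  imports "HOL-Analysis.Analysis" "HOL-Library.Function_Algebras"
begin

section \<open>Functions as a real vector space\<close>

instantiation "fun" :: (type, real_vector) real_vector
begin

definition scaleR_fun :: "real \<Rightarrow> ('a \<Rightarrow> 'b) \<Rightarrow> 'a \<Rightarrow> 'b"
  where "scaleR_fun c f = (\<lambda>x. c *\<^sub>R f x)"

instance
  by standard (simp_all add: scaleR_fun_def fun_eq_iff scaleR_add_right scaleR_add_left)

end

lemma scaleR_fun_apply [simp]: "(c *\<^sub>R f) x = c *\<^sub>R f x"
  by (simp add: scaleR_fun_def)


section \<open>Frechet spaces and Frechet algebras\<close>

locale topological_real_vector_space =
  fixes V :: "'a::real_vector set" and T :: "'a topology"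
  assumes subspace_carrier: "subspace V"
    and topspace_eq: "topspace T = V"
    and continuous_add: "continuous_map (prod_topology T T) T (\<lambda>(f, g). f + g)"
    and continuous_scaleR: "continuous_map (prod_topology euclideanreal T) T (\<lambda>(c, f). c *\<^sub>R f)"

locale frechet_space = topological_real_vector_space +
  assumes locally_convex:
      "\<And>U. openin T U \<Longrightarrow> 0 \<in> U \<Longrightarrow> \<exists>W. openin T W \<and> 0 \<in> W \<and> convex W \<and> W \<subseteq> U"
    and complete_invariant_metric:
      "\<exists>d. Metric_space V d \<and> (\<forall>f\<in>V. \<forall>g\<in>V. \<forall>h\<in>V. d (f + h) (g + h) = d f g)
           \<and> Metric_space.mcomplete V d \<and> Metric_space.mtopology V d = T"

locale frechet_algebra = frechet_space V T
  for V :: "'a::real_vector set" and T :: "'a topology" +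
  fixes mult :: "'a \<Rightarrow> 'a \<Rightarrow> 'a"  (infixl \<open>\<odot>\<close> 70)
  assumes mult_closed: "\<And>f g. f \<in> V \<Longrightarrow> g \<in> V \<Longrightarrow> f \<odot> g \<in> V"
    and mult_scaleR_left: "\<And>c f g. f \<in> V \<Longrightarrow> g \<in> V \<Longrightarrow> c *\<^sub>R (f \<odot> g) = (c *\<^sub>R f) \<odot> g"
    and mult_scaleR_right: "\<And>c f g. f \<in> V \<Longrightarrow> g \<in> V \<Longrightarrow> c *\<^sub>R (f \<odot> g) = f \<odot> (c *\<^sub>R g)"
    and mult_assoc: "\<And>f g h. f \<in> V \<Longrightarrow> g \<in> V \<Longrightarrow> h \<in> V \<Longrightarrow> (f \<odot> g) \<odot> h = f \<odot> (g \<odot> h)"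
    and mult_add_right: "\<And>f g h. f \<in> V \<Longrightarrow> g \<in> V \<Longrightarrow> h \<in> V \<Longrightarrow> f \<odot> (g + h) = f \<odot> g + f \<odot> h"
    and mult_add_left: "\<And>f g h. f \<in> V \<Longrightarrow> g \<in> V \<Longrightarrow> h \<in> V \<Longrightarrow> (f + g) \<odot> h = f \<odot> h + g \<odot> h"
    and continuous_mult: "continuous_map (prod_topology T T) T (\<lambda>(f, g). f \<odot> g)"

locale commutative_frechet_algebra = frechet_algebra +
  assumes mult_commute: "\<And>f g. f \<in> V \<Longrightarrow> g \<in> V \<Longrightarrow> f \<odot> g = g \<odot> f"

definition seminorm_topology :: "'a::real_vector set \<Rightarrow> ('a \<Rightarrow> real) set \<Rightarrow> 'a topology"
  where "seminorm_topology V P =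
    topology_generated_by (insert V {{g \<in> V. p (g - f) < \<epsilon>} | p f \<epsilon>. p \<in> P \<and> f \<in> V \<and> 0 < \<epsilon>})"

lemma topspace_seminorm_topology [simp]: "topspace (seminorm_topology V P) = V"
  by (auto simp: seminorm_topology_def)


section \<open>The Schwartz space on the positive half-line and the Mellin convolution\<close>

text \<open>
  A function on the positive reals is represented by its extension by 0 to the real line,
  so that equality of representatives is equality on the positive reals. As the half-line
  is open, iterated derivatives at positive points depend only on the values there.
\<close>

definition schwartz_pos :: "(real \<Rightarrow> real) set"
  where "schwartz_pos = {f. (\<forall>x\<le>0. f x = 0)
    \<and> (\<forall>n. \<forall>x>0. (deriv ^^ n) f differentiable (at x))
    \<and> (\<forall>(\<alpha>::int) (\<beta>::nat). bdd_above ((\<lambda>x. \<bar>x powi \<alpha> * (deriv ^^ \<beta>) f x\<bar>) ` {0<..}))}"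

definition schwartz_seminorm :: "int \<Rightarrow> nat \<Rightarrow> (real \<Rightarrow> real) \<Rightarrow> real"
  where "schwartz_seminorm \<alpha> \<beta> f = (SUP x\<in>{0<..}. \<bar>x powi \<alpha> * (deriv ^^ \<beta>) f x\<bar>)"

definition schwartz_topology :: "(real \<Rightarrow> real) topology"
  where "schwartz_topology =
    seminorm_topology schwartz_pos {schwartz_seminorm \<alpha> \<beta> | \<alpha> \<beta>. True}"

definition mellin_integrand :: "(real \<Rightarrow> real) \<Rightarrow> (real \<Rightarrow> real) \<Rightarrow> real \<Rightarrow> real \<Rightarrow> real"
  where "mellin_integrand f g x y = inverse y * f (x * inverse y) * g y"

definition mellin_convolution :: "(real \<Rightarrow> real) \<Rightarrow> (real \<Rightarrow> real) \<Rightarrow> real \<Rightarrow> real"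
  where "mellin_convolution f g x =
    (if x > 0 then LINT y:{0<..}|lborel. mellin_integrand f g x y else 0)"

end

theory Submission
  imports Defs "HOL-Probability.Sinc_Integral"
begin

text \<open>
  Two ideas carry the theorem.

  The first concerns the topology. Only countably many seminorms define it, so it is
  metrised by the supremum over \<open>n\<close> of the truncations \<open>min (1 / (n + 1)) (p n (f - g))\<close>, and every
  axiom of a Frechet space reduces to elementary seminorm estimates, except completeness. For
  completeness, all derivatives of a Cauchy sequence converge pointwise, and the point is that the
  limit of the derivatives is the derivative of the limit. This follows from the Taylor estimate
  \<open>\<bar>u t - u x - (t - x) * u' x\<bar> \<le> M * (t - x)\<^sup>2\<close> with \<open>M\<close> a bound for the second derivative on the
  whole half-line: such a bound holds uniformly along the sequence, so the inequality survives
  pointwise limits, and it determines the derivative (\<open>second_order_remainder\<close>,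
  \<open>DERIV_if_second_order_remainder\<close>, \<open>schwartz_complete\<close>).

  The same inequality, integrated against a weight, differentiates
  \<open>\<integral> u (x / y) * w y dy\<close> under the integral sign without any appeal to dominated convergence
  (\<open>has_derivative_dilation_integral\<close>). Applied repeatedly it shows that the \<open>n\<close>-th derivative of the
  convolution is \<open>\<integral> f\<^sup>(\<^sup>n\<^sup>) (x / y) * y powi (- 1 - n) * g y dy\<close>. Since
  \<open>x powi \<alpha> = (x / y) powi \<alpha> * y powi \<alpha>\<close>, the factor \<open>x powi \<alpha>\<close> can be split between \<open>f\<close> and \<open>g\<close>, which
  bounds the \<open>(\<alpha>, n)\<close> seminorm of the convolution by the \<open>(\<alpha>, n)\<close> seminorm of \<open>f\<close> times the absolute
  moment of \<open>g\<close> of order \<open>\<alpha> - 1 - n\<close>. That moment is at most \<open>\<pi>\<close> times a sum of two seminorms of \<open>g\<close>.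
  This single estimate (\<open>mellin_derivative_bound\<close>) yields both closure under the
  product and its joint continuity.

  The second idea concerns the algebra. The substitution \<open>y = exp t\<close> turns the Mellin convolution
  into the ordinary convolution of \<open>f \<circ> exp\<close> and \<open>g \<circ> exp\<close> on the real line, where commutativity is
  the reflection \<open>t \<mapsto> s - t\<close> and associativity is Fubini's theorem together with a translation.
\<close>

section \<open>Frechet spaces from countably many seminorms\<close>

locale separating_seminorms =
  fixes V :: "'a::real_vector set" and p :: "nat \<Rightarrow> 'a \<Rightarrow> real"
  assumes subspace: "subspace V"
    and triangle: "\<And>n f g. f \<in> V \<Longrightarrow> g \<in> V \<Longrightarrow> p n (f + g) \<le> p n f + p n g"
    and homogeneous: "\<And>n c f. f \<in> V \<Longrightarrow> p n (c *\<^sub>R f) = \<bar>c\<bar> * p n f"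
    and separating: "\<And>f. f \<in> V \<Longrightarrow> (\<And>n. p n f = 0) \<Longrightarrow> f = 0"
begin

abbreviation T :: "'a topology"
  where "T \<equiv> seminorm_topology V (range p)"

lemma closed_ops [simp]:
  "0 \<in> V" "f \<in> V \<Longrightarrow> g \<in> V \<Longrightarrow> f + g \<in> V" "f \<in> V \<Longrightarrow> g \<in> V \<Longrightarrow> f - g \<in> V" "f \<in> V \<Longrightarrow> c *\<^sub>R f \<in> V"
  using subspace by (simp_all add: subspace_0 subspace_add subspace_diff subspace_scale)

lemma zero [simp]: "p n 0 = 0"
  using homogeneous[of 0 n 0] by simp

lemma minus_commute: "f \<in> V \<Longrightarrow> g \<in> V \<Longrightarrow> p n (f - g) = p n (g - f)"
  using homogeneous[of "g - f" n "-1"] by simp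

lemma nonneg: "f \<in> V \<Longrightarrow> 0 \<le> p n f"
  using triangle[of f "- f" n] homogeneous[of f n "-1"] closed_ops(4)[of f "-1"] by simp

lemma triangle_diff:
  assumes "f \<in> V" "g \<in> V" "h \<in> V"
  shows "p n (f - h) \<le> p n (f - g) + p n (g - h)"
  using triangle[of "f - g" "g - h" n] assms by simp

lemma openin_seminorm_ball:
  assumes "f \<in> V" "0 < \<epsilon>"
  shows "openin T {g \<in> V. p n (g - f) < \<epsilon>}"
  unfolding seminorm_topology_def using assms by (intro topology_generated_by_Basis) blast

lemma continuous_map_seminorm:
  assumes h: "h \<in> V"
  shows "continuous_map T euclideanreal (\<lambda>f. p n (f - h))"
proof -
  have "openin T {f \<in> V. p n (f - h) \<in> U}" if U: "open U" for U :: "real set"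
  proof (subst openin_subopen, intro ballI)
    fix f assume "f \<in> {f \<in> V. p n (f - h) \<in> U}"
    then have f: "f \<in> V" "p n (f - h) \<in> U" by auto
    then obtain \<epsilon> where \<epsilon>: "\<epsilon> > 0" "\<And>t. dist t (p n (f - h)) < \<epsilon> \<Longrightarrow> t \<in> U"
      using U by (metis open_dist)
    have "p n (g - h) \<in> U" if g: "g \<in> V" "p n (g - f) < \<epsilon>" for g
    proof -
      have "dist (p n (g - h)) (p n (f - h)) \<le> p n (g - f)"
        using triangle_diff[of g f h n] triangle_diff[of f g h n] minus_commute[of f g n] f g h
        by (simp add: dist_real_def)
      with g \<epsilon> show ?thesis by force
    qed
    then show "\<exists>W. openin T W \<and> f \<in> W \<and> W \<subseteq> {f \<in> V. p n (f - h) \<in> U}"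
      using openin_seminorm_ball[OF f(1) \<epsilon>(1), of n] f \<epsilon>
      by (intro exI[of _ "{g \<in> V. p n (g - f) < \<epsilon>}"]) auto
  qed
  then show ?thesis by (simp add: continuous_map_def)
qed

text \<open>
  Continuity into the seminorm topology is stated through a real-valued continuous majorant \<open>b\<close>
  that vanishes at the point: for addition, scaling and bilinear maps such a majorant is what the
  triangle inequality produces, so no \<open>\<epsilon>\<close> has to be split.
\<close>
lemma continuous_map_seminormI:
  assumes F: "\<And>x. x \<in> topspace X \<Longrightarrow> F x \<in> V"
    and bound: "\<And>n x. x \<in> topspace X \<Longrightarrow>
      \<exists>b. continuous_map X euclideanreal b \<and> b x = 0 \<and> (\<forall>y\<in>topspace X. p n (F y - F x) \<le> b y)"
  shows "continuous_map X T F"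
proof -
  have ball: "openin X {y \<in> topspace X. p n (F y - h) < \<epsilon>}" if h: "h \<in> V" for n h \<epsilon>
  proof (subst openin_subopen, intro ballI)
    fix x assume "x \<in> {y \<in> topspace X. p n (F y - h) < \<epsilon>}"
    then have x: "x \<in> topspace X" "p n (F x - h) < \<epsilon>" by auto
    from bound[OF x(1), of n] obtain b where b: "continuous_map X euclideanreal b" "b x = 0"
      "\<And>y. y \<in> topspace X \<Longrightarrow> p n (F y - F x) \<le> b y" by blast
    have "openin X {y \<in> topspace X. b y \<in> {..<\<epsilon> - p n (F x - h)}}"
      using b(1) openin_continuous_map_preimage[OF b(1), of "{..<\<epsilon> - p n (F x - h)}"] by simp
    moreover have "p n (F y - h) < \<epsilon>" if "y \<in> topspace X" "b y < \<epsilon> - p n (F x - h)" for y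
      using triangle_diff[of "F y" "F x" h n] b(3)[OF that(1)] F[OF that(1)] F[OF x(1)] h that by linarith
    ultimately show "\<exists>W. openin X W \<and> x \<in> W \<and> W \<subseteq> {y \<in> topspace X. p n (F y - h) < \<epsilon>}"
      using x b(2) by (intro exI[of _ "{y \<in> topspace X. b y \<in> {..<\<epsilon> - p n (F x - h)}}"]) auto
  qed
  show ?thesis
    unfolding seminorm_topology_def continuous_on_generated_topo_iff
  proof (intro conjI allI impI)
    fix U assume "U \<in> insert V {{g \<in> V. q (g - f) < \<epsilon>} |q f \<epsilon>. q \<in> range p \<and> f \<in> V \<and> 0 < \<epsilon>}"
    then consider "U = V" | n f \<epsilon> where "U = {g \<in> V. p n (g - f) < \<epsilon>}" "f \<in> V" by auto
    then show "openin X (F -` U \<inter> topspace X)"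
    proof cases
      case 1
      then have "F -` U \<inter> topspace X = topspace X" using F by auto
      then show ?thesis by simp
    next
      case 2
      then have "F -` U \<inter> topspace X = {y \<in> topspace X. p n (F y - f) < \<epsilon>}" using F by auto
      then show ?thesis using ball 2 by simp
    qed
  qed (use F in auto)
qed

lemma continuous_map_seminorm_comp:
  assumes "h \<in> V" "continuous_map X T F"
  shows "continuous_map X euclideanreal (\<lambda>x. p n (F x - h))"
  using continuous_map_compose[OF assms(2) continuous_map_seminorm[OF assms(1)], of n]
  by (simp add: o_def)

lemma topological_real_vector_space: "topological_real_vector_space V T"
proof
  show "continuous_map (prod_topology T T) T (\<lambda>(f, g). f + g)"
  proof (rule continuous_map_seminormI)
    fix n x assume "x \<in> topspace (prod_topology T T)"
    then obtain f g where x: "x = (f, g)" "f \<in> V" "g \<in> V" by auto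
    have "p n (f' + g' - (f + g)) \<le> p n (f' - f) + p n (g' - g)" if "f' \<in> V" "g' \<in> V" for f' g'
      using triangle[of "f' - f" "g' - g" n] that x by (simp add: algebra_simps)
    then show "\<exists>b. continuous_map (prod_topology T T) euclideanreal b \<and> b x = 0 \<and>
      (\<forall>y\<in>topspace (prod_topology T T). p n ((case y of (f, g) \<Rightarrow> f + g) - (case x of (f, g) \<Rightarrow> f + g)) \<le> b y)"
      using x
      by (intro exI[of _ "\<lambda>y. p n (fst y - f) + p n (snd y - g)"] conjI continuous_map_add
            continuous_map_seminorm_comp continuous_map_fst continuous_map_snd) auto
  qed auto
next
  show "continuous_map (prod_topology euclideanreal T) T (\<lambda>(c, f). c *\<^sub>R f)"
  proof (rule continuous_map_seminormI)
    fix n and x :: "real \<times> 'a" assume "x \<in> topspace (prod_topology euclideanreal T)"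
    then obtain c f where x: "x = (c, f)" "f \<in> V" by auto
    have "p n (c' *\<^sub>R f' - c *\<^sub>R f) \<le> \<bar>c'\<bar> * p n (f' - f) + \<bar>c' - c\<bar> * p n f" if "f' \<in> V" for c' f'
      using triangle[of "c' *\<^sub>R (f' - f)" "(c' - c) *\<^sub>R f" n] that x homogeneous[of f n "c' - c"]
        homogeneous[of "f' - f" n c']
      by (simp add: algebra_simps)
    then show "\<exists>b. continuous_map (prod_topology euclideanreal T) euclideanreal b \<and> b x = 0 \<and>
      (\<forall>y\<in>topspace (prod_topology euclideanreal T).
         p n ((case y of (c, f) \<Rightarrow> c *\<^sub>R f) - (case x of (c, f) \<Rightarrow> c *\<^sub>R f)) \<le> b y)"
      using x
      by (intro exI[of _ "\<lambda>y. \<bar>fst y\<bar> * p n (snd y - f) + \<bar>fst y - c\<bar> * p n f"] conjI continuous_map_add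
            continuous_map_real_mult continuous_map_real_abs continuous_map_diff
            continuous_map_seminorm_comp continuous_map_fst continuous_map_snd) auto
  qed auto
qed (simp_all add: subspace)

text \<open>
  The majorant comes from \<open>B f' g' - B f g = B (f' - f) g' + B f (g' - g)\<close>. The right-hand factor
  of the bound is a sum of two seminorms because that is the form in which an absolute moment
  is estimated, namely by one seminorm near \<open>0\<close> and another near infinity.
\<close>
lemma continuous_map_bilinear:
  assumes closed: "\<And>f g. f \<in> V \<Longrightarrow> g \<in> V \<Longrightarrow> B f g \<in> V"
    and diff_left: "\<And>f f' g. f \<in> V \<Longrightarrow> f' \<in> V \<Longrightarrow> g \<in> V \<Longrightarrow> B (f - f') g = B f g - B f' g"
    and diff_right: "\<And>f g g'. f \<in> V \<Longrightarrow> g \<in> V \<Longrightarrow> g' \<in> V \<Longrightarrow> B f (g - g') = B f g - B f g'"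
    and bound: "\<And>n. \<exists>k l m C. \<forall>f\<in>V. \<forall>g\<in>V. p n (B f g) \<le> C * p k f * (p l g + p m g)"
  shows "continuous_map (prod_topology T T) T (\<lambda>(f, g). B f g)"
proof (rule continuous_map_seminormI)
  fix n x assume "x \<in> topspace (prod_topology T T)"
  then obtain f g where x: "x = (f, g)" "f \<in> V" "g \<in> V" by auto
  obtain k l m C where bd: "\<And>f g. f \<in> V \<Longrightarrow> g \<in> V \<Longrightarrow> p n (B f g) \<le> C * p k f * (p l g + p m g)"
    using bound[of n] by blast
  have "p n (B f' g' - B f g) \<le>
      C * p k (f' - f) * (p l (g' - 0) + p m (g' - 0)) + C * p k f * (p l (g' - g) + p m (g' - g))"
    if f'g': "f' \<in> V" "g' \<in> V" for f' g'
  proof -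
    have "B f' g' - B f g = B (f' - f) g' + B f (g' - g)"
      using x f'g' by (simp add: diff_left diff_right)
    then show ?thesis
      using triangle[of "B (f' - f) g'" "B f (g' - g)" n] bd[of "f' - f" g'] bd[of f "g' - g"] x f'g' closed
      by simp
  qed
  then show "\<exists>b. continuous_map (prod_topology T T) euclideanreal b \<and> b x = 0 \<and>
      (\<forall>y\<in>topspace (prod_topology T T). p n ((case y of (f, g) \<Rightarrow> B f g) - (case x of (f, g) \<Rightarrow> B f g)) \<le> b y)"
    using x
    by (intro exI[of _ "\<lambda>y. C * p k (fst y - f) * (p l (snd y - 0) + p m (snd y - 0))
            + C * p k f * (p l (snd y - g) + p m (snd y - g))"] conjI continuous_map_add
          continuous_map_real_mult continuous_map_seminorm_comp continuous_map_fst continuous_map_snd) auto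
qed (auto simp: closed)

text \<open>
  A supremum of truncated seminorms replaces the usual weighted series: it makes
  \<open>seminorm_dist f g \<le> e\<close> a statement about each seminorm separately. The value \<open>0\<close> off \<open>V\<close> is
  needed because a metric in the sense of \<^locale>\<open>Metric_space\<close> is nonnegative and symmetric on the
  whole type.
\<close>
definition seminorm_dist :: "'a \<Rightarrow> 'a \<Rightarrow> real"
  where "seminorm_dist f g =
    (if f \<in> V \<and> g \<in> V then SUP n. min (inverse (real (Suc n))) (p n (f - g)) else 0)"

lemma seminorm_dist_le_iff:
  assumes "f \<in> V" "g \<in> V"
  shows "seminorm_dist f g \<le> e \<longleftrightarrow> (\<forall>n. min (inverse (real (Suc n))) (p n (f - g)) \<le> e)"
proof -
  have "bdd_above (range (\<lambda>n. min (inverse (real (Suc n))) (p n (f - g))))"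
    by (intro bdd_aboveI[of _ 1]) (auto simp: min_le_iff_disj field_simps)
  then show ?thesis
    unfolding seminorm_dist_def using assms by (simp add: cSUP_le_iff)
qed

lemma seminorm_dist_ge:
  assumes "f \<in> V" "g \<in> V"
  shows "min (inverse (real (Suc n))) (p n (f - g)) \<le> seminorm_dist f g"
  using seminorm_dist_le_iff[OF assms, of "seminorm_dist f g"] by blast

lemma seminorm_less_if_dist_less:
  assumes "f \<in> V" "g \<in> V" "seminorm_dist f g < min (inverse (real (Suc n))) \<epsilon>"
  shows "p n (f - g) < \<epsilon>"
  using assms seminorm_dist_ge[of f g n] by auto

lemma dist_less_if_seminorms_less:
  assumes "0 < \<epsilon>"
  obtains N \<delta> where "0 < \<delta>"
    "\<And>f g. f \<in> V \<Longrightarrow> g \<in> V \<Longrightarrow> (\<And>n. n < N \<Longrightarrow> p n (f - g) < \<delta>) \<Longrightarrow> seminorm_dist f g < \<epsilon>"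
proof -
  \<comment> \<open>From index \<open>N\<close> on the truncation alone keeps the terms below \<open>\<epsilon> / 2\<close>.\<close>
  obtain N where N: "inverse (real (Suc N)) < \<epsilon> / 2"
    using reals_Archimedean[of "\<epsilon> / 2"] assms by auto
  have "seminorm_dist f g < \<epsilon>"
    if fg: "f \<in> V" "g \<in> V" and small: "\<And>n. n < N \<Longrightarrow> p n (f - g) < \<epsilon> / 2" for f g
  proof -
    have "min (inverse (real (Suc n))) (p n (f - g)) \<le> \<epsilon> / 2" for n
    proof (cases "n < N")
      case True
      then show ?thesis using small[of n] by auto
    next
      case False
      then have "inverse (real (Suc n)) \<le> inverse (real (Suc N))" by (simp add: field_simps)
      with N show ?thesis by linarith
    qed
    then have "seminorm_dist f g \<le> \<epsilon> / 2" using seminorm_dist_le_iff[OF fg] by blast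
    with assms show ?thesis by linarith
  qed
  with assms show ?thesis by (intro that[of "\<epsilon> / 2" N]) auto
qed

lemma Metric_space_seminorm_dist: "Metric_space V seminorm_dist"
proof
  fix f g
  show "0 \<le> seminorm_dist f g"
  proof (cases "f \<in> V \<and> g \<in> V")
    case True
    then have "0 \<le> min (inverse (real (Suc 0))) (p 0 (f - g))" by (simp add: nonneg)
    also have "\<dots> \<le> seminorm_dist f g" using True by (intro seminorm_dist_ge) auto
    finally show ?thesis .
  qed (auto simp: seminorm_dist_def)
  show "seminorm_dist f g = seminorm_dist g f"
    by (simp add: seminorm_dist_def minus_commute)
next
  fix f g assume fg: "f \<in> V" "g \<in> V"
  have "p n (f - g) \<le> 0" if "seminorm_dist f g = 0" for n
    using seminorm_dist_ge[OF fg, of n] that by (auto simp: min_le_iff_disj)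
  then have "f = g" if "seminorm_dist f g = 0"
    using that separating[of "f - g"] nonneg[of "f - g"] fg by (simp add: order_antisym)
  moreover have "seminorm_dist f f = 0"
    using fg by (simp add: seminorm_dist_def)
  ultimately show "seminorm_dist f g = 0 \<longleftrightarrow> f = g" by auto
next
  fix f g h assume V: "f \<in> V" "g \<in> V" "h \<in> V"
  show "seminorm_dist f h \<le> seminorm_dist f g + seminorm_dist g h"
    unfolding seminorm_dist_le_iff[OF V(1,3)]
  proof
    fix n
    have "min (inverse (real (Suc n))) (p n (f - h))
        \<le> min (inverse (real (Suc n))) (p n (f - g)) + min (inverse (real (Suc n))) (p n (g - h))"
      using triangle_diff[OF V, of n] nonneg[of "f - g" n] nonneg[of "g - h" n] V
        positive_imp_inverse_positive[of "real (Suc n)"]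
      unfolding min_def by (smt (verit, best) closed_ops(3) of_nat_0_less_iff zero_less_Suc)
    also have "\<dots> \<le> seminorm_dist f g + seminorm_dist g h"
      using V by (intro add_mono seminorm_dist_ge)
    finally show "min (inverse (real (Suc n))) (p n (f - h)) \<le> seminorm_dist f g + seminorm_dist g h" .
  qed
qed

interpretation metric: Metric_space V seminorm_dist
  by (rule Metric_space_seminorm_dist)

lemma convex_seminorm_ball: "convex {f \<in> V. p n f < \<epsilon>}"
proof (rule convexI)
  fix f g and a b :: real
  assume f: "f \<in> {f \<in> V. p n f < \<epsilon>}" and g: "g \<in> {f \<in> V. p n f < \<epsilon>}" and ab: "0 \<le> a" "0 \<le> b" "a + b = 1"
  have "p n (a *\<^sub>R f + b *\<^sub>R g) \<le> a * p n f + b * p n g"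
    using triangle[of "a *\<^sub>R f" "b *\<^sub>R g" n] f g ab by (simp add: homogeneous)
  also have "\<dots> < \<epsilon>"
    using f g ab by (intro convex_bound_lt) auto
  finally show "a *\<^sub>R f + b *\<^sub>R g \<in> {f \<in> V. p n f < \<epsilon>}"
    using f g by simp
qed

text \<open>
  Finite intersections of seminorm balls suffice inside a metrically open set. This gives one half
  of the comparison of topologies, and also local convexity, since these intersections are convex.
\<close>
lemma mtopology_nhd_base:
  assumes "openin metric.mtopology U" "f \<in> U"
  obtains N \<delta> where "0 < \<delta>" "{g \<in> V. \<forall>n<N. p n (g - f) < \<delta>} \<subseteq> U"
proof -
  from assms obtain r where r: "r > 0" "metric.mball f r \<subseteq> U" and f: "f \<in> V"
    unfolding metric.openin_mtopology by blast
  obtain N \<delta> where N: "0 < \<delta>"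
    "\<And>f g. f \<in> V \<Longrightarrow> g \<in> V \<Longrightarrow> (\<And>n. n < N \<Longrightarrow> p n (f - g) < \<delta>) \<Longrightarrow> seminorm_dist f g < r"
    using dist_less_if_seminorms_less[OF r(1)] by metis
  have "seminorm_dist f g < r" if "g \<in> V" "\<forall>n<N. p n (g - f) < \<delta>" for g
    using N(2)[OF that(1) f] that(2) by (simp add: metric.commute)
  with r f have "{g \<in> V. \<forall>n<N. p n (g - f) < \<delta>} \<subseteq> U" by (auto simp: subset_iff)
  with N show ?thesis by (intro that)
qed

lemma openin_finite_seminorm_ball:
  assumes "f \<in> V" "0 < \<delta>"
  shows "openin T {g \<in> V. \<forall>n<N. p n (g - f) < \<delta>}"
proof -
  have "{g \<in> V. \<forall>n<N. p n (g - f) < \<delta>} = V \<inter> (\<Inter>n\<in>{..<N}. {g \<in> V. p n (g - f) < \<delta>})"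
    by auto
  moreover have "openin T V"
    using openin_topspace[of T] by simp
  ultimately show ?thesis
    using openin_seminorm_ball[OF assms] by (cases "N = 0") (auto intro!: openin_Int openin_INT2)
qed

lemma mtopology_seminorm_dist: "metric.mtopology = T"
proof (rule topology_eq[THEN iffD2], intro allI iffI)
  fix U assume U: "openin metric.mtopology U"
  show "openin T U"
  proof (subst openin_subopen, intro ballI)
    fix f assume f: "f \<in> U"
    obtain N \<delta> where N: "0 < \<delta>" "{g \<in> V. \<forall>n<N. p n (g - f) < \<delta>} \<subseteq> U"
      by (rule mtopology_nhd_base[OF U f])
    have "f \<in> V" using f U openin_subset by fastforce
    with N openin_finite_seminorm_ball[of f \<delta> N]
    show "\<exists>W. openin T W \<and> f \<in> W \<and> W \<subseteq> U"
      by (intro exI[of _ "{g \<in> V. \<forall>n<N. p n (g - f) < \<delta>}"]) auto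
  qed
next
  have ball: "openin metric.mtopology {g \<in> V. p n (g - f) < \<epsilon>}" if f: "f \<in> V" for n f \<epsilon>
    unfolding metric.openin_mtopology
  proof (intro conjI allI impI)
    fix g assume g: "g \<in> {g \<in> V. p n (g - f) < \<epsilon>}"
    define r where "r = min (inverse (real (Suc n))) (\<epsilon> - p n (g - f))"
    have "p n (h - f) < \<epsilon>" if "h \<in> V" "seminorm_dist g h < r" for h
      using triangle_diff[of h g f n] seminorm_less_if_dist_less[of h g n "\<epsilon> - p n (g - f)"] that f g
      by (simp add: r_def metric.commute)
    then show "\<exists>r>0. metric.mball g r \<subseteq> {g \<in> V. p n (g - f) < \<epsilon>}"
      using g by (intro exI[of _ r]) (auto simp: r_def)
  qed auto
  fix U assume "openin T U"
  then have "generate_topology_on (insert V {{g \<in> V. q (g - f) < \<epsilon>} |q f \<epsilon>. q \<in> range p \<and> f \<in> V \<and> 0 < \<epsilon>}) U"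
    unfolding seminorm_topology_def by (rule openin_topology_generated_by)
  then show "openin metric.mtopology U"
  proof (rule generate_topology_on_coarsest[rotated 2, where T = "openin metric.mtopology"])
    fix S assume "S \<in> insert V {{g \<in> V. q (g - f) < \<epsilon>} |q f \<epsilon>. q \<in> range p \<and> f \<in> V \<and> 0 < \<epsilon>}"
    then show "openin metric.mtopology S"
      using ball openin_topspace[of metric.mtopology] by auto
  qed simp
qed

text \<open>
  Completeness is the one property that does not follow from the seminorm axioms. It is enough to
  assume it for sequences that are Cauchy in every seminorm.
\<close>
lemma frechet_spaceI:
  assumes complete: "\<And>\<sigma>. (\<And>i. \<sigma> i \<in> V) \<Longrightarrow>
      (\<And>n \<epsilon>. 0 < \<epsilon> \<Longrightarrow> \<exists>N. \<forall>i\<ge>N. \<forall>j\<ge>N. p n (\<sigma> i - \<sigma> j) < \<epsilon>) \<Longrightarrow>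
      \<exists>f\<in>V. \<forall>n. (\<lambda>i. p n (\<sigma> i - f)) \<longlonglongrightarrow> 0"
  shows "frechet_space V T"
proof -
  interpret topological_real_vector_space V T
    by (rule topological_real_vector_space)
  have mcomplete: "metric.mcomplete"
    unfolding metric.mcomplete_def
  proof (intro allI impI)
    fix \<sigma> assume C: "metric.MCauchy \<sigma>"
    then have V: "\<sigma> i \<in> V" for i by (auto simp: metric.MCauchy_def)
    have "\<exists>N. \<forall>i\<ge>N. \<forall>j\<ge>N. p n (\<sigma> i - \<sigma> j) < \<epsilon>" if "0 < \<epsilon>" for n \<epsilon>
    proof -
      have "0 < min (inverse (real (Suc n))) \<epsilon>" using that by simp
      then obtain N where "\<forall>i j. N \<le> i \<longrightarrow> N \<le> j \<longrightarrow> seminorm_dist (\<sigma> i) (\<sigma> j) < min (inverse (real (Suc n))) \<epsilon>"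
        using C unfolding metric.MCauchy_def by blast
      then show ?thesis using seminorm_less_if_dist_less[OF V V] by blast
    qed
    then obtain f where f: "f \<in> V" "\<And>n. (\<lambda>i. p n (\<sigma> i - f)) \<longlonglongrightarrow> 0"
      using complete[of \<sigma>] V by blast
    have "eventually (\<lambda>i. seminorm_dist (\<sigma> i) f < \<epsilon>) sequentially" if \<epsilon>: "0 < \<epsilon>" for \<epsilon>
    proof -
      obtain N \<delta> where N: "0 < \<delta>"
        "\<And>f g. f \<in> V \<Longrightarrow> g \<in> V \<Longrightarrow> (\<And>n. n < N \<Longrightarrow> p n (f - g) < \<delta>) \<Longrightarrow> seminorm_dist f g < \<epsilon>"
        using dist_less_if_seminorms_less[OF \<epsilon>] by metis
      have "eventually (\<lambda>i. \<forall>n\<in>{..<N}. p n (\<sigma> i - f) < \<delta>) sequentially"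
        using order_tendstoD(2)[OF f(2) N(1)] by (intro eventually_ball_finite) auto
      then show ?thesis
        by eventually_elim (use N(2) V f(1) in auto)
    qed
    with f(1) V show "\<exists>f. limitin metric.mtopology \<sigma> f sequentially"
      by (auto simp: metric.limitin_metric)
  qed
  show ?thesis
  proof
    fix U assume U: "openin T U" "0 \<in> U"
    obtain N \<delta> where N: "0 < \<delta>" "{g \<in> V. \<forall>n<N. p n (g - 0) < \<delta>} \<subseteq> U"
      by (rule mtopology_nhd_base[unfolded mtopology_seminorm_dist, OF U])
    have "{g \<in> V. \<forall>n<N. p n (g - 0) < \<delta>} = V \<inter> (\<Inter>n\<in>{..<N}. {g \<in> V. p n g < \<delta>})"
      by auto
    then have "convex {g \<in> V. \<forall>n<N. p n (g - 0) < \<delta>}"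
      using subspace_imp_convex[OF subspace] convex_seminorm_ball
      by (simp add: convex_INT convex_Int)
    with N openin_finite_seminorm_ball[of 0 \<delta> N]
    show "\<exists>W. openin T W \<and> 0 \<in> W \<and> convex W \<and> W \<subseteq> U"
      by (intro exI[of _ "{g \<in> V. \<forall>n<N. p n (g - 0) < \<delta>}"]) auto
  next
    have "seminorm_dist (f + h) (g + h) = seminorm_dist f g" if "f \<in> V" "g \<in> V" "h \<in> V" for f g h
      using that by (simp add: seminorm_dist_def)
    with Metric_space_seminorm_dist mcomplete mtopology_seminorm_dist
    show "\<exists>d. Metric_space V d \<and> (\<forall>f\<in>V. \<forall>g\<in>V. \<forall>h\<in>V. d (f + h) (g + h) = d f g)
           \<and> Metric_space.mcomplete V d \<and> Metric_space.mtopology V d = T"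
      by blast
  qed
qed

end


section \<open>Derivatives from a quadratic remainder\<close>

text \<open>
  The mean value inequality is used twice: it makes \<open>u'\<close> Lipschitz with constant \<open>M\<close>, and then
  controls \<open>u z - z * u' x\<close>, whose derivative \<open>u' z - u' x\<close> is therefore small. Hence the constant
  \<open>M\<close> in place of the \<open>M / 2\<close> of Taylor's theorem.
\<close>
lemma second_order_remainder:
  fixes u u' u'' :: "real \<Rightarrow> real"
  assumes u: "\<And>z. 0 < z \<Longrightarrow> (u has_real_derivative u' z) (at z)"
    and u': "\<And>z. 0 < z \<Longrightarrow> (u' has_real_derivative u'' z) (at z)"
    and M: "\<And>z. 0 < z \<Longrightarrow> \<bar>u'' z\<bar> \<le> M"
    and pos: "0 < x" "0 < t"
  shows "\<bar>u t - u x - (t - x) * u' x\<bar> \<le> M * (t - x)\<^sup>2"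
proof -
  define S where "S = closed_segment x t"
  have S: "0 < z" "\<bar>z - x\<bar> \<le> \<bar>t - x\<bar>" if "z \<in> S" for z
    using that pos by (auto simp: S_def closed_segment_eq_real_ivl split: if_splits)
  have M0: "0 \<le> M" using M[OF pos(1)] by linarith
  have lip: "\<bar>u' z - u' x\<bar> \<le> M * \<bar>t - x\<bar>" if "z \<in> S" for z
  proof -
    have "norm (u' z - u' x) \<le> M * norm (z - x)"
    proof (rule field_differentiable_bound[of S u' u''])
      show "(u' has_real_derivative u'' y) (at y within S)" if "y \<in> S" for y
        by (rule has_field_derivative_at_within[OF u'[OF S(1)[OF that]]])
      show "norm (u'' y) \<le> M" if "y \<in> S" for y
        using M[OF S(1)[OF that]] by simp
    qed (use that in \<open>auto simp: S_def\<close>)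
    also have "\<dots> \<le> M * \<bar>t - x\<bar>"
      using S(2)[OF that] M0 by (simp add: mult_left_mono)
    finally show ?thesis by simp
  qed
  have "norm ((u t - t * u' x) - (u x - x * u' x)) \<le> (M * \<bar>t - x\<bar>) * norm (t - x)"
  proof (rule field_differentiable_bound[of S "\<lambda>z. u z - z * u' x" "\<lambda>z. u' z - u' x"])
    fix z assume z: "z \<in> S"
    have "((\<lambda>z. u z - z * u' x) has_real_derivative u' z - u' x) (at z)"
      by (auto intro!: derivative_eq_intros u S(1)[OF z])
    then show "((\<lambda>z. u z - z * u' x) has_real_derivative u' z - u' x) (at z within S)"
      by (rule has_field_derivative_at_within)
    show "norm (u' z - u' x) \<le> M * \<bar>t - x\<bar>" using lip[OF z] by simp
  qed (auto simp: S_def)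
  moreover have "(u t - t * u' x) - (u x - x * u' x) = u t - u x - (t - x) * u' x"
    by (simp add: algebra_simps)
  ultimately show ?thesis
    by (simp add: power2_eq_square mult.assoc)
qed

text \<open>
  Together with \<open>second_order_remainder\<close> this trades differentiability for an inequality, which
  passes to pointwise limits and to integrals.
\<close>
lemma DERIV_if_second_order_remainder:
  fixes \<phi> :: "real \<Rightarrow> real"
  assumes x: "0 < x"
    and rem: "\<And>t. 0 < t \<Longrightarrow> \<bar>\<phi> t - \<phi> x - (t - x) * D\<bar> \<le> K * (t - x)\<^sup>2"
  shows "(\<phi> has_real_derivative D) (at x)"
  unfolding has_field_derivative_iff LIM_def
proof (intro allI impI)
  fix r :: real assume r: "0 < r"
  define s where "s = min x (r / (\<bar>K\<bar> + 1))"
  have s: "0 < s" using x r by (simp add: s_def)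
  have "\<bar>(\<phi> t - \<phi> x) / (t - x) - D\<bar> < r" if t: "t \<noteq> x" "\<bar>t - x\<bar> < s" for t
  proof -
    have "0 < t" using t s_def by auto
    then have "\<bar>\<phi> t - \<phi> x - (t - x) * D\<bar> \<le> K * (t - x)\<^sup>2" by (rule rem)
    also have "\<dots> = K * \<bar>t - x\<bar> * \<bar>t - x\<bar>" by (simp add: power2_eq_square mult.assoc)
    finally have "\<bar>\<phi> t - \<phi> x - (t - x) * D\<bar> / \<bar>t - x\<bar> \<le> K * \<bar>t - x\<bar>"
      using t by (simp add: divide_le_eq)
    also have "\<bar>\<phi> t - \<phi> x - (t - x) * D\<bar> / \<bar>t - x\<bar> = \<bar>(\<phi> t - \<phi> x) / (t - x) - D\<bar>"
      using t by (simp add: abs_divide[symmetric] diff_divide_distrib)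
    also have "K * \<bar>t - x\<bar> \<le> (\<bar>K\<bar> + 1) * \<bar>t - x\<bar>" by (intro mult_right_mono) auto
    also have "\<dots> < r"
      using t(2) by (simp add: s_def field_simps)
    finally show ?thesis .
  qed
  with s show "\<exists>s>0. \<forall>t. t \<noteq> x \<and> dist t x < s \<longrightarrow> dist ((\<phi> t - \<phi> x) / (t - x)) D < r"
    by (auto intro!: exI[of _ s] simp: dist_real_def)
qed

section \<open>The Schwartz space on the half-line\<close>

text \<open>
  Iterated derivatives are never computed; a candidate \<open>F n\<close> for each of them is guessed and verified
  one step at a time. The equation holds at positive points only, but these form an open set, so it
  can be differentiated there.
\<close>
lemma deriv_funpow_eq_tower:
  fixes F :: "nat \<Rightarrow> real \<Rightarrow> real"
  assumes eq: "\<And>x. 0 < x \<Longrightarrow> f x = F 0 x"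
    and F: "\<And>n x. 0 < x \<Longrightarrow> (F n has_real_derivative F (Suc n) x) (at x)"
    and x: "0 < x"
  shows "(deriv ^^ n) f x = F n x"
  using x
proof (induction n arbitrary: x)
  case (Suc n)
  have "((deriv ^^ n) f has_real_derivative F (Suc n) x) (at x)"
    by (rule has_field_derivative_transform_within_open[OF F, of _ "{0<..}"]) (use Suc in auto)
  then show ?case by (simp add: DERIV_imp_deriv)
qed (use eq in simp)

lemma schwartz_posI:
  fixes F :: "nat \<Rightarrow> real \<Rightarrow> real"
  assumes supp: "\<And>x. x \<le> 0 \<Longrightarrow> f x = 0"
    and eq: "\<And>x. 0 < x \<Longrightarrow> f x = F 0 x"
    and F: "\<And>n x. 0 < x \<Longrightarrow> (F n has_real_derivative F (Suc n) x) (at x)"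
    and bd: "\<And>\<alpha> n. \<exists>C. \<forall>x>0. \<bar>x powi \<alpha> * F n x\<bar> \<le> C"
  shows "f \<in> schwartz_pos"
proof -
  note tower = deriv_funpow_eq_tower[OF eq F]
  have "(deriv ^^ n) f differentiable (at x)" if "0 < x" for n x
  proof -
    have "((deriv ^^ n) f has_real_derivative F (Suc n) x) (at x)"
      by (rule has_field_derivative_transform_within_open[OF F, of _ "{0<..}"]) (use that tower in auto)
    then show ?thesis by (auto simp: real_differentiable_def)
  qed
  moreover have "bdd_above ((\<lambda>x. \<bar>x powi \<alpha> * (deriv ^^ n) f x\<bar>) ` {0<..})" for \<alpha> n
    using bd[of \<alpha> n] tower by (force intro: bdd_aboveI2)
  ultimately show ?thesis using supp by (simp add: schwartz_pos_def)
qed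

lemma schwartz_pos_eq_0: "f \<in> schwartz_pos \<Longrightarrow> x \<le> 0 \<Longrightarrow> f x = 0"
  by (simp add: schwartz_pos_def)

lemma schwartz_pos_has_derivative:
  assumes "f \<in> schwartz_pos" "0 < x"
  shows "((deriv ^^ n) f has_real_derivative (deriv ^^ Suc n) f x) (at x)"
  using assms by (simp add: schwartz_pos_def DERIV_deriv_iff_real_differentiable)

lemma schwartz_seminorm_ge:
  assumes "f \<in> schwartz_pos" "0 < x"
  shows "\<bar>x powi \<alpha> * (deriv ^^ n) f x\<bar> \<le> schwartz_seminorm \<alpha> n f"
  unfolding schwartz_seminorm_def
  by (rule cSUP_upper) (use assms in \<open>auto simp: schwartz_pos_def\<close>)

lemma schwartz_seminorm_le:
  assumes "\<And>x. 0 < x \<Longrightarrow> \<bar>x powi \<alpha> * (deriv ^^ n) f x\<bar> \<le> C"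
  shows "schwartz_seminorm \<alpha> n f \<le> C"
  unfolding schwartz_seminorm_def by (rule cSUP_least) (use assms in auto)

lemma schwartz_derivative_bound:
  assumes "f \<in> schwartz_pos" "0 < x"
  shows "\<bar>(deriv ^^ n) f x\<bar> \<le> schwartz_seminorm 0 n f"
  using schwartz_seminorm_ge[OF assms, of 0 n] by simp

lemma zero_in_schwartz_pos: "0 \<in> schwartz_pos"
  by (rule schwartz_posI[of _ "\<lambda>_ _. 0"]) auto

lemma deriv_funpow_lincomb:
  assumes "f \<in> schwartz_pos" "g \<in> schwartz_pos" "0 < x"
  shows "(deriv ^^ n) (a *\<^sub>R f + b *\<^sub>R g) x = a * (deriv ^^ n) f x + b * (deriv ^^ n) g x"
  by (rule deriv_funpow_eq_tower[where F = "\<lambda>n x. a * (deriv ^^ n) f x + b * (deriv ^^ n) g x"])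
    (use assms in \<open>auto intro!: derivative_eq_intros schwartz_pos_has_derivative simp del: funpow.simps simp: funpow_0\<close>)

lemma schwartz_lincomb_bound:
  assumes "f \<in> schwartz_pos" "g \<in> schwartz_pos" "0 < x"
  shows "\<bar>x powi \<alpha> * (a * (deriv ^^ n) f x + b * (deriv ^^ n) g x)\<bar>
    \<le> \<bar>a\<bar> * schwartz_seminorm \<alpha> n f + \<bar>b\<bar> * schwartz_seminorm \<alpha> n g"
proof -
  have "\<bar>x powi \<alpha> * (a * (deriv ^^ n) f x + b * (deriv ^^ n) g x)\<bar>
      = \<bar>a * (x powi \<alpha> * (deriv ^^ n) f x) + b * (x powi \<alpha> * (deriv ^^ n) g x)\<bar>"
    by (simp add: algebra_simps)
  also have "\<dots> \<le> \<bar>a\<bar> * \<bar>x powi \<alpha> * (deriv ^^ n) f x\<bar> + \<bar>b\<bar> * \<bar>x powi \<alpha> * (deriv ^^ n) g x\<bar>"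
    by (metis abs_mult abs_triangle_ineq)
  also have "\<dots> \<le> \<bar>a\<bar> * schwartz_seminorm \<alpha> n f + \<bar>b\<bar> * schwartz_seminorm \<alpha> n g"
    using assms by (intro add_mono mult_left_mono schwartz_seminorm_ge) auto
  finally show ?thesis .
qed

lemma schwartz_pos_lincomb:
  assumes f: "f \<in> schwartz_pos" and g: "g \<in> schwartz_pos"
  shows "a *\<^sub>R f + b *\<^sub>R g \<in> schwartz_pos"
proof (rule schwartz_posI[where F = "\<lambda>n x. a * (deriv ^^ n) f x + b * (deriv ^^ n) g x"])
  show "((\<lambda>x. a * (deriv ^^ n) f x + b * (deriv ^^ n) g x) has_real_derivative
      a * (deriv ^^ Suc n) f x + b * (deriv ^^ Suc n) g x) (at x)" if "0 < x" for n x
    using that f g by (auto intro!: derivative_eq_intros schwartz_pos_has_derivative simp del: funpow.simps)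
  show "\<exists>C. \<forall>x>0. \<bar>x powi \<alpha> * (a * (deriv ^^ n) f x + b * (deriv ^^ n) g x)\<bar> \<le> C" for \<alpha> n
    using schwartz_lincomb_bound[OF f g] by blast
qed (use f g in \<open>auto simp: schwartz_pos_eq_0\<close>)

lemma subspace_schwartz_pos: "subspace schwartz_pos"
  unfolding subspace_def
  using zero_in_schwartz_pos schwartz_pos_lincomb[of _ _ 1 1] schwartz_pos_lincomb[of _ 0 _ 0]
  by simp

lemma schwartz_seminorm_scaleR:
  assumes "f \<in> schwartz_pos"
  shows "schwartz_seminorm \<alpha> n (c *\<^sub>R f) = \<bar>c\<bar> * schwartz_seminorm \<alpha> n f"
proof -
  have le: "schwartz_seminorm \<alpha> n (c *\<^sub>R f) \<le> \<bar>c\<bar> * schwartz_seminorm \<alpha> n f"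
    if "f \<in> schwartz_pos" for c f
  proof (rule schwartz_seminorm_le)
    fix x :: real assume x: "0 < x"
    show "\<bar>x powi \<alpha> * (deriv ^^ n) (c *\<^sub>R f) x\<bar> \<le> \<bar>c\<bar> * schwartz_seminorm \<alpha> n f"
      using deriv_funpow_lincomb[OF that zero_in_schwartz_pos x, of n c 0]
        schwartz_lincomb_bound[OF that zero_in_schwartz_pos x, of \<alpha> c n 0] by simp
  qed
  show ?thesis
  proof (cases "c = 0")
    case True
    have "schwartz_seminorm \<alpha> n (0 :: real \<Rightarrow> real) = 0"
    proof -
      have "(deriv ^^ n) (0 :: real \<Rightarrow> real) x = 0" if "0 < x" for x
        by (rule deriv_funpow_eq_tower[where F = "\<lambda>_ _. 0"]) (use that in auto)
      then have "(\<lambda>x. \<bar>x powi \<alpha> * (deriv ^^ n) (0 :: real \<Rightarrow> real) x\<bar>) ` {0<..} = {0}"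
        by (auto simp: image_constant_conv intro!: image_eqI[of _ _ 1])
      then show ?thesis by (simp add: schwartz_seminorm_def)
    qed
    with True show ?thesis by simp
  next
    case False
    have "c *\<^sub>R f \<in> schwartz_pos"
      using assms subspace_schwartz_pos by (simp add: subspace_scale)
    \<comment> \<open>The reverse inequality is the first one for \<open>c *\<^sub>R f\<close> and the scalar \<open>inverse c\<close>.\<close>
    from le[OF this, of "inverse c"] False
    have "\<bar>c\<bar> * schwartz_seminorm \<alpha> n f \<le> schwartz_seminorm \<alpha> n (c *\<^sub>R f)"
      by (simp add: field_simps)
    with le[OF assms, of c] show ?thesis by simp
  qed
qed

definition schwartz_seminorm_seq :: "nat \<Rightarrow> (real \<Rightarrow> real) \<Rightarrow> real"
  where "schwartz_seminorm_seq k = (case from_nat k of (\<alpha>, n) \<Rightarrow> schwartz_seminorm \<alpha> n)"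

lemma schwartz_seminorm_seq_cases:
  obtains \<alpha> n where "schwartz_seminorm_seq k = schwartz_seminorm \<alpha> n"
  by (metis case_prod_conv schwartz_seminorm_seq_def surj_pair)

lemma schwartz_seminorm_seq_index:
  obtains k where "schwartz_seminorm_seq k = schwartz_seminorm \<alpha> n"
  using that[of "to_nat (\<alpha>, n)"] by (simp add: schwartz_seminorm_seq_def)

lemma range_schwartz_seminorm_seq: "range schwartz_seminorm_seq = {schwartz_seminorm \<alpha> n |\<alpha> n. True}"
  by (auto elim: schwartz_seminorm_seq_cases schwartz_seminorm_seq_index) 
     (metis rangeI schwartz_seminorm_seq_cases schwartz_seminorm_seq_index)+

interpretation schwartz: separating_seminorms schwartz_pos schwartz_seminorm_seq
proof
  show "subspace schwartz_pos" by (rule subspace_schwartz_pos)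
next
  fix k f g assume fg: "f \<in> schwartz_pos" "g \<in> schwartz_pos"
  obtain \<alpha> n where k: "schwartz_seminorm_seq k = schwartz_seminorm \<alpha> n"
    by (rule schwartz_seminorm_seq_cases)
  show "schwartz_seminorm_seq k (f + g) \<le> schwartz_seminorm_seq k f + schwartz_seminorm_seq k g"
    unfolding k
  proof (rule schwartz_seminorm_le)
    fix x :: real assume x: "0 < x"
    show "\<bar>x powi \<alpha> * (deriv ^^ n) (f + g) x\<bar> \<le> schwartz_seminorm \<alpha> n f + schwartz_seminorm \<alpha> n g"
      using deriv_funpow_lincomb[OF fg x, of n 1 1] schwartz_lincomb_bound[OF fg x, of \<alpha> 1 n 1] by simp
  qed
next
  fix k c f assume "f \<in> schwartz_pos"
  then show "schwartz_seminorm_seq k (c *\<^sub>R f) = \<bar>c\<bar> * schwartz_seminorm_seq k f"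
    using schwartz_seminorm_scaleR schwartz_seminorm_seq_cases by metis
next
  fix f assume f: "f \<in> schwartz_pos" and 0: "\<And>k. schwartz_seminorm_seq k f = 0"
  obtain k where "schwartz_seminorm_seq k = schwartz_seminorm 0 0"
    by (rule schwartz_seminorm_seq_index)
  with 0 have "schwartz_seminorm 0 0 f = 0" by metis
  then have "f x = 0" if "0 < x" for x
    using schwartz_derivative_bound[OF f that, of 0] by simp
  with schwartz_pos_eq_0[OF f] show "f = 0"
    by (metis ext not_le zero_fun_apply)
qed

lemma schwartz_topology_eq: "schwartz_topology = schwartz.T"
  by (simp add: schwartz_topology_def range_schwartz_seminorm_seq)

text \<open>
  All derivatives converge pointwise, and the limits \<open>F n\<close> form a tower of derivatives because the
  quadratic remainder estimates of the members hold with a common constant. Letting one index of the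
  Cauchy condition tend to infinity at each point gives convergence in every seminorm.
\<close>
lemma schwartz_complete:
  fixes \<sigma> :: "nat \<Rightarrow> real \<Rightarrow> real"
  assumes \<sigma>: "\<And>i. \<sigma> i \<in> schwartz_pos"
    and Cauchy: "\<And>\<alpha> n \<epsilon>. 0 < \<epsilon> \<Longrightarrow> \<exists>N. \<forall>i\<ge>N. \<forall>j\<ge>N. schwartz_seminorm \<alpha> n (\<sigma> i - \<sigma> j) < \<epsilon>"
  shows "\<exists>f\<in>schwartz_pos. \<forall>\<alpha> n. (\<lambda>i. schwartz_seminorm \<alpha> n (\<sigma> i - f)) \<longlonglongrightarrow> 0"
proof -
  have dist_bound: "\<bar>x powi \<alpha> * ((deriv ^^ n) (\<sigma> i) x - (deriv ^^ n) (\<sigma> j) x)\<bar>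
      \<le> schwartz_seminorm \<alpha> n (\<sigma> i - \<sigma> j)" if x: "0 < x" for x \<alpha> n i j
    using schwartz_seminorm_ge[of "\<sigma> i - \<sigma> j", OF _ x, of \<alpha> n] \<sigma>
      deriv_funpow_lincomb[OF \<sigma> \<sigma> x, of n 1 i "-1" j] by simp
  have "convergent (\<lambda>i. (deriv ^^ n) (\<sigma> i) x)" if x: "0 < x" for n x
  proof (rule real_Cauchy_convergent, unfold Cauchy_def, intro allI impI)
    fix \<epsilon> :: real assume "0 < \<epsilon>"
    then obtain N where "\<forall>i\<ge>N. \<forall>j\<ge>N. schwartz_seminorm 0 n (\<sigma> i - \<sigma> j) < \<epsilon>"
      using Cauchy by blast
    then show "\<exists>N. \<forall>i\<ge>N. \<forall>j\<ge>N. dist ((deriv ^^ n) (\<sigma> i) x) ((deriv ^^ n) (\<sigma> j) x) < \<epsilon>"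
      using dist_bound[OF x, of 0 n] by (intro exI[of _ N]) (simp add: dist_real_def, meson le_less_trans)
  qed
  moreover define F where "F n x = lim (\<lambda>i. (deriv ^^ n) (\<sigma> i) x)" for n x
  ultimately have F: "(\<lambda>i. (deriv ^^ n) (\<sigma> i) x) \<longlonglongrightarrow> F n x" if "0 < x" for n x
    using that by (simp add: convergent_LIMSEQ_iff)
  have close: "\<exists>N. \<forall>i\<ge>N. \<forall>x>0. \<bar>x powi \<alpha> * ((deriv ^^ n) (\<sigma> i) x - F n x)\<bar> \<le> \<epsilon>" if \<epsilon>: "0 < \<epsilon>" for \<alpha> n \<epsilon>
  proof -
    obtain N where N: "\<forall>i\<ge>N. \<forall>j\<ge>N. schwartz_seminorm \<alpha> n (\<sigma> i - \<sigma> j) < \<epsilon>"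
      using Cauchy[OF \<epsilon>] by blast
    have "\<bar>x powi \<alpha> * ((deriv ^^ n) (\<sigma> i) x - F n x)\<bar> \<le> \<epsilon>" if i: "N \<le> i" and x: "0 < x" for i x
    proof (rule LIMSEQ_le_const2)
      show "(\<lambda>j. \<bar>x powi \<alpha> * ((deriv ^^ n) (\<sigma> i) x - (deriv ^^ n) (\<sigma> j) x)\<bar>)
          \<longlonglongrightarrow> \<bar>x powi \<alpha> * ((deriv ^^ n) (\<sigma> i) x - F n x)\<bar>"
        by (intro tendsto_intros F x)
      show "\<exists>M. \<forall>j\<ge>M. \<bar>x powi \<alpha> * ((deriv ^^ n) (\<sigma> i) x - (deriv ^^ n) (\<sigma> j) x)\<bar> \<le> \<epsilon>"
        using N i dist_bound[OF x] by (intro exI[of _ N]) (meson less_imp_le order_trans)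
    qed
    then show ?thesis by blast
  qed
  have bounded: "\<exists>C. \<forall>\<^sub>F i in sequentially. \<forall>x>0. \<bar>x powi \<alpha> * (deriv ^^ n) (\<sigma> i) x\<bar> \<le> C" for \<alpha> n
  proof -
    obtain N where N: "\<forall>i\<ge>N. \<forall>j\<ge>N. schwartz_seminorm \<alpha> n (\<sigma> i - \<sigma> j) < 1"
      using Cauchy[of 1 \<alpha> n] by auto
    have "\<bar>x powi \<alpha> * (deriv ^^ n) (\<sigma> i) x\<bar> \<le> 1 + schwartz_seminorm \<alpha> n (\<sigma> N)" if "N \<le> i" "0 < x" for i x
    proof -
      have "schwartz_seminorm \<alpha> n (\<sigma> i - \<sigma> N) < 1" using N that by blast
      moreover have "\<bar>x powi \<alpha> * (deriv ^^ n) (\<sigma> i) x\<bar>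
          \<le> \<bar>x powi \<alpha> * ((deriv ^^ n) (\<sigma> i) x - (deriv ^^ n) (\<sigma> N) x)\<bar> + \<bar>x powi \<alpha> * (deriv ^^ n) (\<sigma> N) x\<bar>"
        by (simp add: right_diff_distrib)
      ultimately show ?thesis
        using dist_bound[OF that(2), of \<alpha> n i N] schwartz_seminorm_ge[OF \<sigma>[of N] that(2), of \<alpha> n] by linarith
    qed
    then show ?thesis unfolding eventually_sequentially by blast
  qed
  have F_deriv: "(F n has_real_derivative F (Suc n) x) (at x)" if x: "0 < x" for n x
  proof -
    \<comment> \<open>One bound for the derivatives of order \<open>n + 2\<close> serves almost all members of the sequence.\<close>
    obtain C where C: "\<forall>\<^sub>F i in sequentially. \<forall>x>0. \<bar>(deriv ^^ Suc (Suc n)) (\<sigma> i) x\<bar> \<le> C"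
      using bounded[of 0 "Suc (Suc n)"] by auto
    show ?thesis
    proof (rule DERIV_if_second_order_remainder[OF x])
      fix t :: real assume t: "0 < t"
      show "\<bar>F n t - F n x - (t - x) * F (Suc n) x\<bar> \<le> C * (t - x)\<^sup>2"
      proof (rule tendsto_upperbound)
        show "(\<lambda>i. \<bar>(deriv ^^ n) (\<sigma> i) t - (deriv ^^ n) (\<sigma> i) x - (t - x) * (deriv ^^ Suc n) (\<sigma> i) x\<bar>)
            \<longlonglongrightarrow> \<bar>F n t - F n x - (t - x) * F (Suc n) x\<bar>"
          by (intro tendsto_intros F x t)
        show "\<forall>\<^sub>F i in sequentially. \<bar>(deriv ^^ n) (\<sigma> i) t - (deriv ^^ n) (\<sigma> i) x
            - (t - x) * (deriv ^^ Suc n) (\<sigma> i) x\<bar> \<le> C * (t - x)\<^sup>2"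
          using C
        proof eventually_elim
          case (elim i)
          show ?case
            by (rule second_order_remainder[where u'' = "(deriv ^^ Suc (Suc n)) (\<sigma> i)"])
              (use elim x t \<sigma> in \<open>simp_all add: schwartz_pos_has_derivative del: funpow.simps\<close>)
        qed
      qed simp
    qed
  qed
  define f where "f x = (if 0 < x then F 0 x else 0)" for x
  have f: "f \<in> schwartz_pos"
  proof (rule schwartz_posI[of _ F])
    fix \<alpha> n
    obtain N where N: "\<forall>i\<ge>N. \<forall>x>0. \<bar>x powi \<alpha> * ((deriv ^^ n) (\<sigma> i) x - F n x)\<bar> \<le> 1"
      using close[of 1 \<alpha> n] by auto
    have "\<bar>x powi \<alpha> * F n x\<bar> \<le> 1 + schwartz_seminorm \<alpha> n (\<sigma> N)" if "0 < x" for x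
    proof -
      have "\<bar>x powi \<alpha> * ((deriv ^^ n) (\<sigma> N) x - F n x)\<bar> \<le> 1" using N that by blast
      moreover have "\<bar>x powi \<alpha> * F n x\<bar>
          \<le> \<bar>x powi \<alpha> * ((deriv ^^ n) (\<sigma> N) x - F n x)\<bar> + \<bar>x powi \<alpha> * (deriv ^^ n) (\<sigma> N) x\<bar>"
        by (simp add: right_diff_distrib)
      ultimately show ?thesis
        using schwartz_seminorm_ge[OF \<sigma>[of N] that, of \<alpha> n] by linarith
    qed
    then show "\<exists>C. \<forall>x>0. \<bar>x powi \<alpha> * F n x\<bar> \<le> C" by blast
  qed (auto simp: f_def F_deriv)
  have df: "(deriv ^^ n) f x = F n x" if "0 < x" for n x
    by (rule deriv_funpow_eq_tower) (use that F_deriv in \<open>auto simp: f_def\<close>)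
  have "(\<lambda>i. schwartz_seminorm \<alpha> n (\<sigma> i - f)) \<longlonglongrightarrow> 0" for \<alpha> n
  proof (rule LIMSEQ_I)
    fix r :: real assume r: "0 < r"
    then obtain N where N: "\<forall>i\<ge>N. \<forall>x>0. \<bar>x powi \<alpha> * ((deriv ^^ n) (\<sigma> i) x - F n x)\<bar> \<le> r / 2"
      using close[of "r / 2" \<alpha> n] by auto
    have "norm (schwartz_seminorm \<alpha> n (\<sigma> i - f) - 0) < r" if i: "N \<le> i" for i
    proof -
      have "schwartz_seminorm \<alpha> n (\<sigma> i - f) \<le> r / 2"
      proof (rule schwartz_seminorm_le)
        fix x :: real assume x: "0 < x"
        show "\<bar>x powi \<alpha> * (deriv ^^ n) (\<sigma> i - f) x\<bar> \<le> r / 2"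
          using deriv_funpow_lincomb[OF \<sigma>[of i] f x, of n 1 "-1"] df[OF x] N i x by simp
      qed
      moreover have "0 \<le> schwartz_seminorm \<alpha> n (\<sigma> i - f)"
        using schwartz_seminorm_ge[of "\<sigma> i - f" 1 \<alpha> n] \<sigma> f by simp
      ultimately show ?thesis using r by simp
    qed
    then show "\<exists>N. \<forall>i\<ge>N. norm (schwartz_seminorm \<alpha> n (\<sigma> i - f) - 0) < r" by blast
  qed
  with f show ?thesis by blast
qed

lemma frechet_space_schwartz: "frechet_space schwartz_pos schwartz_topology"
  unfolding schwartz_topology_eq
proof (rule schwartz.frechet_spaceI)
  fix \<sigma> :: "nat \<Rightarrow> real \<Rightarrow> real"
  assume \<sigma>: "\<And>i. \<sigma> i \<in> schwartz_pos"
    and C: "\<And>k \<epsilon>. 0 < \<epsilon> \<Longrightarrow> \<exists>N. \<forall>i\<ge>N. \<forall>j\<ge>N. schwartz_seminorm_seq k (\<sigma> i - \<sigma> j) < \<epsilon>"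
  have "\<exists>N. \<forall>i\<ge>N. \<forall>j\<ge>N. schwartz_seminorm \<alpha> n (\<sigma> i - \<sigma> j) < \<epsilon>" if "0 < \<epsilon>" for \<alpha> n \<epsilon>
  proof -
    obtain k where "schwartz_seminorm_seq k = schwartz_seminorm \<alpha> n"
      by (rule schwartz_seminorm_seq_index)
    with C[OF that, of k] show ?thesis by simp
  qed
  then obtain f where f: "f \<in> schwartz_pos"
      "\<And>\<alpha> n. (\<lambda>i. schwartz_seminorm \<alpha> n (\<sigma> i - f)) \<longlonglongrightarrow> 0"
    using schwartz_complete[of \<sigma>] \<sigma> by blast
  have "(\<lambda>i. schwartz_seminorm_seq k (\<sigma> i - f)) \<longlonglongrightarrow> 0" for k
    by (rule schwartz_seminorm_seq_cases[of k]) (simp add: f(2))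
  with f(1) show "\<exists>f\<in>schwartz_pos. \<forall>k. (\<lambda>i. schwartz_seminorm_seq k (\<sigma> i - f)) \<longlonglongrightarrow> 0"
    by blast
qed


section \<open>Moments and dilation integrals\<close>

lemma set_borel_measurable_continuous_pos:
  fixes u :: "real \<Rightarrow> real"
  assumes "continuous_on {0<..} u"
  shows "set_borel_measurable lborel {0<..} u"
  using borel_measurable_continuous_on_indicator[OF _ assms]
  by (simp add: set_borel_measurable_def)

lemma set_integral_abs_le:
  fixes f g :: "'a \<Rightarrow> real"
  assumes "set_integrable M A f" "set_integrable M A g" "\<And>x. x \<in> A \<Longrightarrow> \<bar>f x\<bar> \<le> g x"
  shows "\<bar>LINT x:A|M. f x\<bar> \<le> (LINT x:A|M. g x)"
proof -
  have "\<bar>LINT x:A|M. f x\<bar> \<le> (LINT x:A|M. \<bar>f x\<bar>)"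
    using set_integral_norm_bound[OF assms(1)] by simp
  also have "\<dots> \<le> (LINT x:A|M. g x)"
    by (intro set_integral_mono set_integrable_abs assms)
  finally show ?thesis .
qed

lemma
  shows integrable_inverse_one_plus_square: "integrable lborel (\<lambda>x::real. inverse (1 + x\<^sup>2))"
    and integral_inverse_one_plus_square: "(LINT x|lborel. inverse (1 + x\<^sup>2)) = pi"
  using integrable_inverse_1_plus_square LBINT_inverse_1_plus_square
  by (simp_all add: set_integrable_def interval_lebesgue_integral_def set_lebesgue_integral_def)

lemma schwartz_pos_continuous:
  assumes "f \<in> schwartz_pos"
  shows "continuous_on {0<..} ((deriv ^^ n) f)"
  by (rule DERIV_continuous_on[of _ _ "(deriv ^^ Suc n) f"])
    (use schwartz_pos_has_derivative[OF assms] in \<open>auto intro: has_field_derivative_at_within simp del: funpow.simps\<close>)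

text \<open>
  The two seminorms together bound \<open>(1 + y\<^sup>2) * \<bar>y powi a * g y\<bar>\<close>, and \<open>1 / (1 + y\<^sup>2)\<close> has integral \<open>\<pi>\<close>
  over the real line.
\<close>
lemma schwartz_moment:
  assumes g: "g \<in> schwartz_pos"
  shows set_integrable_schwartz_moment: "set_integrable lborel {0<..} (\<lambda>y. y powi a * g y)"
    and schwartz_moment_le: "(LINT y:{0<..}|lborel. \<bar>y powi a * g y\<bar>)
      \<le> pi * (schwartz_seminorm a 0 g + schwartz_seminorm (a + 2) 0 g)"
proof -
  define C where "C = schwartz_seminorm a 0 g + schwartz_seminorm (a + 2) 0 g"
  have bound: "\<bar>y powi a * g y\<bar> \<le> C * inverse (1 + y\<^sup>2)" if y: "0 < y" for y
  proof -
    have "\<bar>y powi a * g y\<bar> * (1 + y\<^sup>2) = \<bar>y powi a * g y\<bar> + \<bar>y powi (a + 2) * g y\<bar>"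
      using y by (simp add: power_int_add abs_mult algebra_simps)
    also have "\<dots> \<le> C"
      using schwartz_seminorm_ge[OF g y, of a 0] schwartz_seminorm_ge[OF g y, of "a + 2" 0]
      by (simp add: C_def)
    finally show ?thesis
      by (simp add: field_simps add_pos_nonneg)
  qed
  have dom: "integrable lborel (\<lambda>y. C * inverse (1 + y\<^sup>2))"
    using integrable_inverse_one_plus_square by simp
  then have dom': "set_integrable lborel {0<..} (\<lambda>y. C * inverse (1 + y\<^sup>2))"
    unfolding set_integrable_def by (rule integrable_mult_indicator[rotated]) simp
  have "continuous_on {0<..} (\<lambda>y. y powi a * g y)"
    using schwartz_pos_continuous[OF g, of 0] by (intro continuous_intros) auto
  then show int: "set_integrable lborel {0<..} (\<lambda>y. y powi a * g y)"
    using bound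
    by (intro set_integrable_bound[OF dom'] set_borel_measurable_continuous_pos)
      (auto intro!: AE_I2 intro: order_trans[OF _ abs_ge_self])
  have "(LINT y:{0<..}|lborel. \<bar>y powi a * g y\<bar>) \<le> (LINT y:{0<..}|lborel. C * inverse (1 + y\<^sup>2))"
    by (intro set_integral_mono set_integrable_abs int dom') (simp add: bound)
  also have "\<dots> \<le> (LINT y|lborel. C * inverse (1 + y\<^sup>2))"
  proof -
    have "0 \<le> C" using bound[of 1] by simp
    then show ?thesis
      unfolding set_lebesgue_integral_def using dom dom'
      by (intro integral_mono) (auto simp: set_integrable_def indicator_def add_pos_nonneg)
  qed
  also have "\<dots> = pi * C"
    using integral_inverse_one_plus_square by simp
  finally show "(LINT y:{0<..}|lborel. \<bar>y powi a * g y\<bar>)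
      \<le> pi * (schwartz_seminorm a 0 g + schwartz_seminorm (a + 2) 0 g)"
    by (simp add: C_def)
qed

lemma dilation_integral:
  fixes u w :: "real \<Rightarrow> real"
  assumes u: "continuous_on {0<..} u" and bound: "\<And>z. 0 < z \<Longrightarrow> \<bar>u z\<bar> \<le> B"
    and w: "set_integrable lborel {0<..} w" and x: "0 < x"
  shows set_integrable_dilation: "set_integrable lborel {0<..} (\<lambda>y. u (x / y) * w y)"
    and dilation_integral_le: "\<bar>LINT y:{0<..}|lborel. u (x / y) * w y\<bar> \<le> B * (LINT y:{0<..}|lborel. \<bar>w y\<bar>)"
proof -
  have le: "\<bar>u (x / y) * w y\<bar> \<le> B * \<bar>w y\<bar>" if "0 < y" for y
    using bound[of "x / y"] that x by (simp add: abs_mult mult_right_mono)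
  have Bw: "set_integrable lborel {0<..} (\<lambda>y. B * \<bar>w y\<bar>)"
    by (intro set_integrable_mult_right impI set_integrable_abs w)
  have "continuous_on {0<..} (\<lambda>y. u (x / y))"
    by (rule continuous_on_compose2[OF u]) (use x in \<open>auto intro!: continuous_intros\<close>)
  then have "set_borel_measurable lborel {0<..} (\<lambda>y. u (x / y))"
    by (rule set_borel_measurable_continuous_pos)
  moreover have "set_borel_measurable lborel {0<..} w"
    using w by (simp add: set_integrable_def set_borel_measurable_def)
  ultimately have "(\<lambda>y. (indicator {0<..} y *\<^sub>R u (x / y)) * (indicator {0<..} y *\<^sub>R w y)) \<in> borel_measurable lborel"
    unfolding set_borel_measurable_def by (rule borel_measurable_times)
  then have "set_borel_measurable lborel {0<..} (\<lambda>y. u (x / y) * w y)"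
    unfolding set_borel_measurable_def by (rule measurable_cong[THEN iffD1, rotated]) (auto simp: indicator_def)
  then show int: "set_integrable lborel {0<..} (\<lambda>y. u (x / y) * w y)"
    using le by (intro set_integrable_bound[OF Bw]) (auto intro!: AE_I2 intro: order_trans[OF _ abs_ge_self])
  have "\<bar>LINT y:{0<..}|lborel. u (x / y) * w y\<bar> \<le> (LINT y:{0<..}|lborel. B * \<bar>w y\<bar>)"
    by (rule set_integral_abs_le[OF int Bw]) (simp add: le)
  then show "\<bar>LINT y:{0<..}|lborel. u (x / y) * w y\<bar> \<le> B * (LINT y:{0<..}|lborel. \<bar>w y\<bar>)"
    by simp
qed

text \<open>
  The quadratic remainder of \<open>u\<close> between \<open>x / y\<close> and \<open>t / y\<close> is at most \<open>B'' * (t - x)\<^sup>2 / y\<^sup>2\<close>. Integrated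
  against \<open>\<bar>w\<bar>\<close> it stays quadratic in \<open>t - x\<close>, as long as \<open>w y / y\<^sup>2\<close> is integrable.
\<close>
lemma has_derivative_dilation_integral:
  fixes u u' u'' w :: "real \<Rightarrow> real"
  assumes u: "\<And>z. 0 < z \<Longrightarrow> (u has_real_derivative u' z) (at z)"
    and u': "\<And>z. 0 < z \<Longrightarrow> (u' has_real_derivative u'' z) (at z)"
    and bounds: "\<And>z. 0 < z \<Longrightarrow> \<bar>u z\<bar> \<le> B" "\<And>z. 0 < z \<Longrightarrow> \<bar>u' z\<bar> \<le> B'" "\<And>z. 0 < z \<Longrightarrow> \<bar>u'' z\<bar> \<le> B''"
    and w: "set_integrable lborel {0<..} w" "set_integrable lborel {0<..} (\<lambda>y. w y / y)"
      "set_integrable lborel {0<..} (\<lambda>y. w y / y\<^sup>2)"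
    and x: "0 < x"
  shows "((\<lambda>x. LINT y:{0<..}|lborel. u (x / y) * w y) has_real_derivative
      (LINT y:{0<..}|lborel. u' (x / y) * (w y / y))) (at x)"
proof (rule DERIV_if_second_order_remainder[OF x])
  have cont: "continuous_on {0<..} u"
    by (rule DERIV_continuous_on[of _ _ u']) (simp add: has_field_derivative_at_within u)
  have cont': "continuous_on {0<..} u'"
    by (rule DERIV_continuous_on[of _ _ u'']) (simp add: has_field_derivative_at_within u')
  have int: "set_integrable lborel {0<..} (\<lambda>y. u (x / y) * w y)" if "0 < x" for x
    by (rule set_integrable_dilation[OF cont bounds(1) w(1) that])
  have int': "set_integrable lborel {0<..} (\<lambda>y. u' (x / y) * (w y / y))"
    by (rule set_integrable_dilation[OF cont' bounds(2) w(2) x])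
  fix t :: real assume t: "0 < t"
  have int2: "set_integrable lborel {0<..} (\<lambda>y. B'' * (t - x)\<^sup>2 * \<bar>w y / y\<^sup>2\<bar>)"
    by (intro set_integrable_mult_right impI set_integrable_abs w)
  have int'': "set_integrable lborel {0<..} (\<lambda>y. (t - x) * (u' (x / y) * (w y / y)))"
    by (intro set_integrable_mult_right impI int')
  have int1: "set_integrable lborel {0<..} (\<lambda>y. u (t / y) * w y - u (x / y) * w y - (t - x) * (u' (x / y) * (w y / y)))"
    by (intro set_integral_diff int int'' x t)
  have linear: "(LINT y:{0<..}|lborel. u (t / y) * w y) - (LINT y:{0<..}|lborel. u (x / y) * w y)
        - (t - x) * (LINT y:{0<..}|lborel. u' (x / y) * (w y / y))
      = (LINT y:{0<..}|lborel. u (t / y) * w y - u (x / y) * w y - (t - x) * (u' (x / y) * (w y / y)))"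
    by (simp only: set_integral_diff int[OF t] int[OF x] int'' set_integral_mult_right)
  have pointwise: "\<bar>u (t / y) * w y - u (x / y) * w y - (t - x) * (u' (x / y) * (w y / y))\<bar>
      \<le> B'' * (t - x)\<^sup>2 * \<bar>w y / y\<^sup>2\<bar>" if "y \<in> {0<..}" for y
  proof -
    have y: "0 < y" using that by simp
    have factor: "u (t / y) * w y - u (x / y) * w y - (t - x) * (u' (x / y) * (w y / y))
        = (u (t / y) - u (x / y) - (t / y - x / y) * u' (x / y)) * w y"
      by (simp add: algebra_simps diff_divide_distrib)
    have "\<bar>(u (t / y) - u (x / y) - (t / y - x / y) * u' (x / y)) * w y\<bar>
        \<le> B'' * (t / y - x / y)\<^sup>2 * \<bar>w y\<bar>"
      unfolding abs_mult using x y t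
      by (intro mult_right_mono second_order_remainder[OF u u' bounds(3)]) auto
    also have "B'' * (t / y - x / y)\<^sup>2 * \<bar>w y\<bar> = B'' * (t - x)\<^sup>2 * \<bar>w y / y\<^sup>2\<bar>"
      by (simp add: diff_divide_distrib[symmetric] power_divide abs_divide)
    finally show ?thesis unfolding factor .
  qed
  have "(LINT y:{0<..}|lborel. B'' * (t - x)\<^sup>2 * \<bar>w y / y\<^sup>2\<bar>)
      = (B'' * (LINT y:{0<..}|lborel. \<bar>w y / y\<^sup>2\<bar>)) * (t - x)\<^sup>2"
    by (subst set_integral_mult_right) (simp only: ac_simps)
  with set_integral_abs_le[OF int1 int2 pointwise]
  show "\<bar>(LINT y:{0<..}|lborel. u (t / y) * w y) - (LINT y:{0<..}|lborel. u (x / y) * w y)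
        - (t - x) * (LINT y:{0<..}|lborel. u' (x / y) * (w y / y))\<bar>
      \<le> (B'' * (LINT y:{0<..}|lborel. \<bar>w y / y\<^sup>2\<bar>)) * (t - x)\<^sup>2"
    unfolding linear by (simp only:)
qed

section \<open>The Mellin convolution of Schwartz functions\<close>

text \<open>
  The \<open>n\<close>-th derivative of the convolution of \<open>f\<close> and \<open>g\<close>, all derivatives falling on \<open>f\<close>; each
  differentiation contributes a factor \<open>1 / y\<close>.
\<close>
definition mellin_derivative :: "(real \<Rightarrow> real) \<Rightarrow> (real \<Rightarrow> real) \<Rightarrow> nat \<Rightarrow> real \<Rightarrow> real"
  where "mellin_derivative f g n x =
    (LINT y:{0<..}|lborel. (deriv ^^ n) f (x / y) * (y powi (- 1 - int n) * g y))"

lemma mellin_integrand_eq: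
  "mellin_integrand f g x y = f (x / y) * (y powi (- 1) * g y)"
  by (simp add: mellin_integrand_def divide_inverse)

lemma mellin_convolution_eq_derivative_0: "0 < x \<Longrightarrow> mellin_convolution f g x = mellin_derivative f g 0 x"
  by (simp add: mellin_convolution_def mellin_derivative_def mellin_integrand_eq[abs_def])

lemma set_integrable_mellin_integrand:
  assumes f: "f \<in> schwartz_pos" and g: "g \<in> schwartz_pos" and x: "0 < x"
  shows "set_integrable lborel {0<..} (mellin_integrand f g x)"
proof -
  have "continuous_on {0<..} f"
    using schwartz_pos_continuous[OF f, of 0] by simp
  moreover have "\<bar>f z\<bar> \<le> schwartz_seminorm 0 0 f" if "0 < z" for z
    using schwartz_derivative_bound[OF f that, of 0] by simp
  ultimately show ?thesis
    unfolding mellin_integrand_eq[abs_def]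
    using set_integrable_schwartz_moment[OF g] x by (rule set_integrable_dilation)
qed

lemma has_derivative_mellin_derivative:
  assumes f: "f \<in> schwartz_pos" and g: "g \<in> schwartz_pos" and x: "0 < x"
  shows "(mellin_derivative f g n has_real_derivative mellin_derivative f g (Suc n) x) (at x)"
proof -
  let ?w = "\<lambda>y. y powi (- 1 - int n) * g y"
  have w1: "?w y / y = y powi (- 1 - int (Suc n)) * g y" if "y \<in> {0<..}" for y
    using that power_int_diff[of y "- 1 - int n" 1] by (simp add: algebra_simps)
  have w2: "?w y / y\<^sup>2 = y powi (- 1 - int n - 2) * g y" if "y \<in> {0<..}" for y
    using that power_int_diff[of y "- 1 - int n" 2] by simp
  have "((\<lambda>x. LINT y:{0<..}|lborel. (deriv ^^ n) f (x / y) * ?w y) has_real_derivative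
      (LINT y:{0<..}|lborel. (deriv ^^ Suc n) f (x / y) * (?w y / y))) (at x)"
  proof (rule has_derivative_dilation_integral[OF schwartz_pos_has_derivative[OF f]
        schwartz_pos_has_derivative[OF f] schwartz_derivative_bound[OF f] schwartz_derivative_bound[OF f]
        schwartz_derivative_bound[OF f] _ _ _ x])
    show "set_integrable lborel {0<..} ?w"
      by (rule set_integrable_schwartz_moment[OF g])
    show "set_integrable lborel {0<..} (\<lambda>y. ?w y / y)"
      by (subst set_integrable_cong[OF refl refl w1]) (auto intro: set_integrable_schwartz_moment[OF g])
    show "set_integrable lborel {0<..} (\<lambda>y. ?w y / y\<^sup>2)"
      by (subst set_integrable_cong[OF refl refl w2]) (auto intro: set_integrable_schwartz_moment[OF g])
  qed
  moreover have "(LINT y:{0<..}|lborel. (deriv ^^ Suc n) f (x / y) * (?w y / y)) = mellin_derivative f g (Suc n) x"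
    unfolding mellin_derivative_def
  proof (intro set_lebesgue_integral_cong allI impI)
    fix y :: real assume "y \<in> {0<..}"
    then show "(deriv ^^ Suc n) f (x / y) * (?w y / y)
        = (deriv ^^ Suc n) f (x / y) * (y powi (- 1 - int (Suc n)) * g y)"
      by (simp only: w1)
  qed simp
  ultimately show ?thesis
    unfolding mellin_derivative_def[of f g n, abs_def] by (simp only:)
qed

text \<open>
  The weight \<open>x powi \<alpha> = (x / y) powi \<alpha> * y powi \<alpha>\<close> is shared between the two factors: one part
  turns the derivative of \<open>f\<close> into a function bounded by its seminorm, the other raises the moment
  of \<open>g\<close> to order \<open>\<alpha> - 1 - n\<close>.
\<close>
lemma mellin_derivative_bound:
  assumes f: "f \<in> schwartz_pos" and g: "g \<in> schwartz_pos" and x: "0 < x"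
  shows "\<bar>x powi \<alpha> * mellin_derivative f g n x\<bar> \<le> pi * schwartz_seminorm \<alpha> n f *
    (schwartz_seminorm (\<alpha> - 1 - int n) 0 g + schwartz_seminorm (\<alpha> - 1 - int n + 2) 0 g)"
proof -
  define a where "a = \<alpha> - 1 - int n"
  let ?u = "\<lambda>z. z powi \<alpha> * (deriv ^^ n) f z"
  have cont: "continuous_on {0<..} ?u"
    by (intro continuous_intros schwartz_pos_continuous[OF f]) auto
  have split: "x powi \<alpha> * ((deriv ^^ n) f (x / y) * (y powi (- 1 - int n) * g y)) = ?u (x / y) * (y powi a * g y)"
    if y: "0 < y" for y
  proof -
    have "y powi a = y powi \<alpha> * y powi (- 1 - int n)"
      using y power_int_add[of y \<alpha> "- 1 - int n"] by (simp add: a_def algebra_simps)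
    then show ?thesis using y by (simp add: power_int_divide_distrib)
  qed
  have eq: "x powi \<alpha> * mellin_derivative f g n x = (LINT y:{0<..}|lborel. ?u (x / y) * (y powi a * g y))"
    unfolding mellin_derivative_def set_integral_mult_right[symmetric]
    by (intro set_lebesgue_integral_cong allI impI) (simp_all only: split greaterThan_iff, simp)
  have "\<bar>x powi \<alpha> * mellin_derivative f g n x\<bar>
      \<le> schwartz_seminorm \<alpha> n f * (LINT y:{0<..}|lborel. \<bar>y powi a * g y\<bar>)"
    unfolding eq
    by (rule dilation_integral_le[OF cont schwartz_seminorm_ge[OF f] set_integrable_schwartz_moment[OF g] x])
  also have "\<dots> \<le> schwartz_seminorm \<alpha> n f * (pi * (schwartz_seminorm a 0 g + schwartz_seminorm (a + 2) 0 g))"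
    using schwartz_seminorm_ge[OF f x, of \<alpha> n]
    by (intro mult_left_mono schwartz_moment_le[OF g]) linarith
  finally show ?thesis by (simp add: a_def mult_ac)
qed

lemma mellin_convolution_in_schwartz_pos:
  assumes f: "f \<in> schwartz_pos" and g: "g \<in> schwartz_pos"
  shows "mellin_convolution f g \<in> schwartz_pos"
proof (rule schwartz_posI[where F = "mellin_derivative f g"])
  show "\<exists>C. \<forall>x>0. \<bar>x powi \<alpha> * mellin_derivative f g n x\<bar> \<le> C" for \<alpha> n
    using mellin_derivative_bound[OF f g] by blast
qed (use f g in \<open>auto simp: mellin_convolution_eq_derivative_0 has_derivative_mellin_derivative\<close>,
    simp add: mellin_convolution_def)

lemma schwartz_seminorm_mellin_convolution_le:
  assumes f: "f \<in> schwartz_pos" and g: "g \<in> schwartz_pos"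
  shows "schwartz_seminorm \<alpha> n (mellin_convolution f g) \<le> pi * schwartz_seminorm \<alpha> n f *
    (schwartz_seminorm (\<alpha> - 1 - int n) 0 g + schwartz_seminorm (\<alpha> - 1 - int n + 2) 0 g)"
proof (rule schwartz_seminorm_le)
  fix x :: real assume x: "0 < x"
  have "(deriv ^^ n) (mellin_convolution f g) x = mellin_derivative f g n x"
    by (rule deriv_funpow_eq_tower)
      (use f g x in \<open>auto simp: mellin_convolution_eq_derivative_0 has_derivative_mellin_derivative\<close>)
  then show "\<bar>x powi \<alpha> * (deriv ^^ n) (mellin_convolution f g) x\<bar> \<le> pi * schwartz_seminorm \<alpha> n f *
    (schwartz_seminorm (\<alpha> - 1 - int n) 0 g + schwartz_seminorm (\<alpha> - 1 - int n + 2) 0 g)"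
    using mellin_derivative_bound[OF f g x, of \<alpha> n] by simp
qed

section \<open>The algebra laws in logarithmic coordinates\<close>

lemma exp_substitution:
  fixes \<phi> :: "real \<Rightarrow> real"
  assumes \<phi>: "set_integrable lborel {0<..} (\<lambda>y. \<phi> y / y)"
  shows integrable_exp_substitution: "integrable lborel (\<lambda>t. \<phi> (exp t))"
    and integral_exp_substitution: "(LINT y:{0<..}|lborel. \<phi> y / y) = (LINT t|lborel. \<phi> (exp t))"
proof -
  \<comment> \<open>Only \<open>\<phi>\<close> cut off to the half-line is known to be measurable, but \<open>exp\<close> sees nothing else.\<close>
  define \<psi> where "\<psi> y = indicator {0<..} y *\<^sub>R (\<phi> y / y)" for y :: real
  have [measurable]: "\<psi> \<in> borel_measurable borel"
    using \<phi> by (auto simp: set_integrable_def \<psi>_def[abs_def])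
  have "(\<lambda>t. exp t * \<psi> (exp t)) \<in> borel_measurable borel" by measurable
  then have meas: "(\<lambda>t. \<phi> (exp t)) \<in> borel_measurable lborel"
    by (simp add: \<psi>_def)
  have range: "range exp = {0::real<..}"
    by (auto simp: image_iff) (metis exp_ln)
  have "(\<lambda>y. \<phi> y / y) absolutely_integrable_on {0<..}"
    using \<phi> unfolding set_integrable_def
    by (subst integrable_completion) (auto dest: borel_measurable_integrable)
  then have "(\<lambda>t. \<bar>exp t\<bar> * (\<phi> (exp t) / exp t)) absolutely_integrable_on UNIV \<and>
      integral UNIV (\<lambda>t. \<bar>exp t\<bar> * (\<phi> (exp t) / exp t)) = integral {0<..} (\<lambda>y. \<phi> y / y)"
    by (subst has_absolute_integral_change_of_variables_1')
      (auto intro!: derivative_eq_intros simp: range inj_on_def)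
  then have sub: "(\<lambda>t. \<phi> (exp t)) absolutely_integrable_on UNIV"
      "integral UNIV (\<lambda>t. \<phi> (exp t)) = integral {0<..} (\<lambda>y. \<phi> y / y)" by simp_all
  then show int: "integrable lborel (\<lambda>t. \<phi> (exp t))"
    using integrable_completion[OF meas] by (simp add: set_integrable_def)
  show "(LINT y:{0<..}|lborel. \<phi> y / y) = (LINT t|lborel. \<phi> (exp t))"
    using set_borel_integral_eq_integral(2)[OF \<phi>] sub(2) integral_lborel[OF int] by simp
qed

lemma schwartz_exp_integrable:
  assumes g: "g \<in> schwartz_pos"
  shows "integrable lborel (\<lambda>t. g (exp t))"
  by (rule integrable_exp_substitution)
    (use set_integrable_schwartz_moment[OF g, of "-1"] in \<open>simp add: divide_inverse mult.commute\<close>)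

lemma mellin_convolution_exp:
  assumes f: "f \<in> schwartz_pos" and g: "g \<in> schwartz_pos"
  shows "mellin_convolution f g (exp s) = (LINT t|lborel. f (exp (s - t)) * g (exp t))"
proof -
  have eq: "mellin_integrand f g (exp s) = (\<lambda>y. f (exp s / y) * g y / y)"
    by (auto simp: mellin_integrand_eq divide_inverse)
  show ?thesis
    using integral_exp_substitution[of "\<lambda>y. f (exp s / y) * g y"]
      set_integrable_mellin_integrand[OF f g, of "exp s"]
    by (simp add: mellin_convolution_def eq exp_diff)
qed

lemma convolution_commute:
  fixes f g :: "real \<Rightarrow> real"
  shows "(LINT t|lborel. f (s - t) * g t) = (LINT t|lborel. g (s - t) * f t)"
  by (subst lborel_integral_real_affine[of "-1" _ s]) (simp_all add: mult.commute)

text \<open>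
  Both sides are iterated integrals of \<open>f (s - t) * g (t - r) * h r\<close>, the right one after the
  translation \<open>t \<mapsto> r + t\<close>. Boundedness of \<open>f\<close> makes this function integrable in the plane, being
  dominated by a multiple of \<open>\<bar>g (t - r)\<bar> * \<bar>h r\<bar>\<close>.
\<close>
lemma convolution_assoc:
  fixes f g h :: "real \<Rightarrow> real"
  assumes int: "integrable lborel f" "integrable lborel g" "integrable lborel h"
    and bound: "\<And>t. \<bar>f t\<bar> \<le> B"
  shows "(LINT t|lborel. f (s - t) * (LINT r|lborel. g (t - r) * h r))
    = (LINT r|lborel. (LINT t|lborel. f (s - r - t) * g t) * h r)"
proof -
  have [measurable]: "f \<in> borel_measurable borel" "g \<in> borel_measurable borel" "h \<in> borel_measurable borel"
    using int by (auto dest: borel_measurable_integrable)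
  define \<Phi> where "\<Phi> r t = f (s - t) * (g (t - r) * h r)" for r t
  have \<Phi>_meas[measurable]: "case_prod \<Phi> \<in> borel_measurable (lborel \<Otimes>\<^sub>M lborel)"
    unfolding \<Phi>_def[abs_def] by measurable
  have \<Phi>_row_meas: "\<Phi> r \<in> borel_measurable borel" for r
    unfolding \<Phi>_def[abs_def] by measurable
  have g_shift: "integrable lborel (\<lambda>t. g (t - r))" for r
    using lborel_integrable_real_affine[OF int(2), of 1 "-r"] by simp
  have \<Phi>_le: "\<bar>\<Phi> r t\<bar> \<le> B * (\<bar>g (t - r)\<bar> * \<bar>h r\<bar>)" for r t
    using bound[of "s - t"] by (simp add: \<Phi>_def abs_mult mult_right_mono)
  have dom: "integrable lborel (\<lambda>t. B * (\<bar>g (t - r)\<bar> * \<bar>h r\<bar>))" for r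
    using g_shift by (intro integrable_mult_right integrable_mult_left integrable_abs)
  have \<Phi>_int: "integrable lborel (\<Phi> r)" for r
    by (rule Bochner_Integration.integrable_bound[OF dom[of r]])
      (use \<Phi>_le in \<open>auto intro!: AE_I2 intro: order_trans[OF _ abs_ge_self] simp: \<Phi>_row_meas\<close>)
  have norm_le: "(LINT t|lborel. \<bar>\<Phi> r t\<bar>) \<le> B * (LINT t|lborel. \<bar>g t\<bar>) * \<bar>h r\<bar>" for r
  proof -
    have "(LINT t|lborel. \<bar>\<Phi> r t\<bar>) \<le> (LINT t|lborel. B * (\<bar>g (t - r)\<bar> * \<bar>h r\<bar>))"
      using \<Phi>_int \<Phi>_le dom by (intro integral_mono integrable_abs) auto
    also have "\<dots> = B * ((LINT t|lborel. \<bar>g (t - r)\<bar>) * \<bar>h r\<bar>)" by simp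
    also have "(LINT t|lborel. \<bar>g (t - r)\<bar>) = (LINT t|lborel. \<bar>g t\<bar>)"
      by (subst (2) lborel_integral_real_affine[of 1 _ "-r"]) simp_all
    finally show ?thesis by (simp add: mult.assoc)
  qed
  have "integrable (lborel \<Otimes>\<^sub>M lborel) (case_prod \<Phi>)"
  proof (rule lborel_pair.Fubini_integrable[OF \<Phi>_meas])
    have "integrable lborel (\<lambda>r. B * (LINT t|lborel. \<bar>g t\<bar>) * \<bar>h r\<bar>)"
      using int(3) by (intro integrable_mult_right integrable_abs)
    then show "integrable lborel (\<lambda>r. LINT t|lborel. norm (case (r, t) of (r, t) \<Rightarrow> \<Phi> r t))"
    proof (rule Bochner_Integration.integrable_bound)
      show "AE r in lborel. norm (LINT t|lborel. norm (case (r, t) of (r, t) \<Rightarrow> \<Phi> r t))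
          \<le> norm (B * (LINT t|lborel. \<bar>g t\<bar>) * \<bar>h r\<bar>)"
        using norm_le by (auto intro!: AE_I2 intro: order_trans[OF _ abs_ge_self])
    qed measurable
  qed (use \<Phi>_int in simp)
  note Fubini = lborel_pair.Fubini_integral[OF this]
  have inner: "(LINT t|lborel. \<Phi> r t) = (LINT t|lborel. f (s - r - t) * g t) * h r" for r
  proof -
    have "(LINT t|lborel. \<Phi> r t) = (LINT t|lborel. \<Phi> r (r + t))"
      by (subst lborel_integral_real_affine[of 1 _ r]) simp_all
    also have "\<dots> = (LINT t|lborel. f (s - r - t) * g t * h r)"
      by (simp add: \<Phi>_def mult.assoc diff_diff_eq)
    finally show ?thesis by simp
  qed
  have "(LINT t|lborel. f (s - t) * (LINT r|lborel. g (t - r) * h r)) = (LINT t|lborel. LINT r|lborel. \<Phi> r t)"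
    by (simp add: \<Phi>_def)
  also have "\<dots> = (LINT r|lborel. LINT t|lborel. \<Phi> r t)" by (rule Fubini)
  finally show ?thesis by (simp add: inner)
qed

text \<open>
  Positive points are the values of \<open>exp\<close>, and elsewhere every convolution vanishes by convention.
\<close>
lemma mellin_convolution_eqI:
  assumes "\<And>s. mellin_convolution f g (exp s) = mellin_convolution f' g' (exp s)"
  shows "mellin_convolution f g = mellin_convolution f' g'"
proof
  fix x
  show "mellin_convolution f g x = mellin_convolution f' g' x"
    using assms[of "ln x"] by (cases "0 < x") (simp_all add: mellin_convolution_def)
qed

lemma mellin_convolution_commute:
  assumes "f \<in> schwartz_pos" "g \<in> schwartz_pos"
  shows "mellin_convolution f g = mellin_convolution g f"
  by (rule mellin_convolution_eqI)
    (use convolution_commute[of "\<lambda>t. f (exp t)" _ "\<lambda>t. g (exp t)"] in \<open>simp add: mellin_convolution_exp assms\<close>)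

lemma mellin_convolution_assoc:
  assumes V: "f \<in> schwartz_pos" "g \<in> schwartz_pos" "h \<in> schwartz_pos"
  shows "mellin_convolution (mellin_convolution f g) h = mellin_convolution f (mellin_convolution g h)"
proof (rule mellin_convolution_eqI)
  fix s
  show "mellin_convolution (mellin_convolution f g) h (exp s) = mellin_convolution f (mellin_convolution g h) (exp s)"
    using convolution_assoc[OF schwartz_exp_integrable[OF V(1)] schwartz_exp_integrable[OF V(2)]
        schwartz_exp_integrable[OF V(3)], of "schwartz_seminorm 0 0 f" s]
      schwartz_derivative_bound[OF V(1), of _ 0]
    by (simp add: mellin_convolution_exp V mellin_convolution_in_schwartz_pos)
qed

lemma mellin_convolution_lincomb_left:
  assumes "f \<in> schwartz_pos" "f' \<in> schwartz_pos" "g \<in> schwartz_pos"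
  shows "mellin_convolution (a *\<^sub>R f + b *\<^sub>R f') g = a *\<^sub>R mellin_convolution f g + b *\<^sub>R mellin_convolution f' g"
proof
  fix x
  have eq: "mellin_integrand (a *\<^sub>R f + b *\<^sub>R f') g x = (\<lambda>y. a * mellin_integrand f g x y + b * mellin_integrand f' g x y)"
    by (auto simp: mellin_integrand_def algebra_simps)
  show "mellin_convolution (a *\<^sub>R f + b *\<^sub>R f') g x = (a *\<^sub>R mellin_convolution f g + b *\<^sub>R mellin_convolution f' g) x"
    using assms by (simp add: mellin_convolution_def eq set_integrable_mellin_integrand)
qed

lemma mellin_convolution_lincomb_right:
  assumes "f \<in> schwartz_pos" "g \<in> schwartz_pos" "g' \<in> schwartz_pos"
  shows "mellin_convolution f (a *\<^sub>R g + b *\<^sub>R g') = a *\<^sub>R mellin_convolution f g + b *\<^sub>R mellin_convolution f g'"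
  using assms mellin_convolution_lincomb_left[of g g' f a b] schwartz_pos_lincomb
  by (simp add: mellin_convolution_commute[of f])

lemma continuous_map_mellin_convolution:
  "continuous_map (prod_topology schwartz_topology schwartz_topology) schwartz_topology
    (\<lambda>(f, g). mellin_convolution f g)"
  unfolding schwartz_topology_eq
proof (rule schwartz.continuous_map_bilinear)
  show "mellin_convolution (f - f') g = mellin_convolution f g - mellin_convolution f' g"
    if "f \<in> schwartz_pos" "f' \<in> schwartz_pos" "g \<in> schwartz_pos" for f f' g
    using mellin_convolution_lincomb_left[OF that, of 1 "-1"] by simp
  show "mellin_convolution f (g - g') = mellin_convolution f g - mellin_convolution f g'"
    if "f \<in> schwartz_pos" "g \<in> schwartz_pos" "g' \<in> schwartz_pos" for f g g'
    using mellin_convolution_lincomb_right[OF that, of 1 "-1"] by simp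
  fix k
  obtain \<alpha> n where k: "schwartz_seminorm_seq k = schwartz_seminorm \<alpha> n"
    by (rule schwartz_seminorm_seq_cases)
  obtain l where l: "schwartz_seminorm_seq l = schwartz_seminorm (\<alpha> - 1 - int n) 0"
    by (rule schwartz_seminorm_seq_index)
  obtain m where m: "schwartz_seminorm_seq m = schwartz_seminorm (\<alpha> - 1 - int n + 2) 0"
    by (rule schwartz_seminorm_seq_index)
  show "\<exists>k' l m C. \<forall>f\<in>schwartz_pos. \<forall>g\<in>schwartz_pos. schwartz_seminorm_seq k (mellin_convolution f g)
      \<le> C * schwartz_seminorm_seq k' f * (schwartz_seminorm_seq l g + schwartz_seminorm_seq m g)"
    using schwartz_seminorm_mellin_convolution_le[of _ _ \<alpha> n]
    by (intro exI[of _ k] exI[of _ l] exI[of _ m] exI[of _ pi]) (auto simp: k l m)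
qed (rule mellin_convolution_in_schwartz_pos)

theorem theorem10:
  shows "(\<forall>f\<in>schwartz_pos. \<forall>g\<in>schwartz_pos. \<forall>x>0.
            set_integrable lborel {0<..} (mellin_integrand f g x))
         \<and> commutative_frechet_algebra schwartz_pos schwartz_topology mellin_convolution"
proof
  show "\<forall>f\<in>schwartz_pos. \<forall>g\<in>schwartz_pos. \<forall>x>0. set_integrable lborel {0<..} (mellin_integrand f g x)"
    using set_integrable_mellin_integrand by blast
  interpret frechet_space schwartz_pos schwartz_topology
    by (rule frechet_space_schwartz)
  show "commutative_frechet_algebra schwartz_pos schwartz_topology mellin_convolution"
  proof
    fix f g h :: "real \<Rightarrow> real" and c :: real
    assume f: "f \<in> schwartz_pos" and g: "g \<in> schwartz_pos"
    show "mellin_convolution f g \<in> schwartz_pos"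
      using f g by (rule mellin_convolution_in_schwartz_pos)
    show "mellin_convolution f g = mellin_convolution g f"
      using f g by (rule mellin_convolution_commute)
    show "c *\<^sub>R mellin_convolution f g = mellin_convolution (c *\<^sub>R f) g"
      using mellin_convolution_lincomb_left[OF f f g, of c 0] by simp
    show "c *\<^sub>R mellin_convolution f g = mellin_convolution f (c *\<^sub>R g)"
      using mellin_convolution_lincomb_right[OF f g g, of c 0] by simp
    assume h: "h \<in> schwartz_pos"
    show "mellin_convolution (mellin_convolution f g) h = mellin_convolution f (mellin_convolution g h)"
      using f g h by (rule mellin_convolution_assoc)
    show "mellin_convolution f (g + h) = mellin_convolution f g + mellin_convolution f h"
      using mellin_convolution_lincomb_right[OF f g h, of 1 1] by simp
    show "mellin_convolution (f + g) h = mellin_convolution f h + mellin_convolution g h"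
      using mellin_convolution_lincomb_left[OF f g h, of 1 1] by simp
  qed (rule continuous_map_mellin_convolution)
qed

end
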